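(* Let $I=(I_1,\dots,I_N)$ be an ordered partition of $[1,n]$. The scalar function $N(\mathbf w)$ in $\widetilde\xi_I=N(\mathbf w)\xi'_I$ is given by $$\begin{aligned}N(\mathbf w)=\ &\theta(q^2)^{\sum_{k=2}^N(k-1)|I_k|}\prod_{1\le k<l\le N}\prod_{a\in I_k}\prod_{\substack{b\in I_l \\ a<b}}\frac{\theta(q^2w_b/w_a)}{\theta(w_b/w_a)}\ \prod_{l=1}^{N-1}\Bigg\{\prod_{\substack{j\in I_{N-l+1}\cup\cdots\cup I_N \\ k\in I_1\cup\cdots\cup I_{N-l-1}}}\theta(w_j/w_k) \\ &\times\prod_{\substack{j\in I_{N-l+1}\cup\cdots\cup I_N \\ k\in I_{N-l}\cup\cdots\cup I_N \\ j<k}}\theta(q^2w_j/w_k)\prod_{\substack{j\in I_{N-l+1}\cup\cdots\cup I_N \\ k\in I_{N-l+1}\cup\cdots\cup I_N \\ j>k}}\theta(q^2w_j/w_k)\prod_{\substack{j\in I_{N-l+1}\cup\cdots\cup I_N \\ k\in I_{N-l} \\ j>k}}\theta(w_j/w_k)\Bigg\}.\end{aligned}$$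
   Context: Notation. $q,p\in\mathbb C^\times$ generic, $|q|,|p|<1$; $(x;p)_\infty=\prod_{n\ge0}(1-xp^n)$, $\Theta_p(z)=(z;p)_\infty(p/z;p)_\infty(p;p)_\infty$, $\theta(z)=-z^{-1/2}\Theta_p(z)$. $\mathbb F$: field of meromorphic functions of the dynamical variables $P_{\epsilon_1},\dots,P_{\epsilon_N}$; $\Pi^*_{j,k}=q^{2(P_{\epsilon_j}-P_{\epsilon_k})}$. The matrix $\widetilde R(z,\Pi^* )=\sum\widetilde R(z,\Pi^* )_{i\mu}^{j\nu}E_{ij}\otimes E_{\mu\nu}$ is $\widetilde R(z,\Pi^* )=\sum_j\theta(q^2z)E_{jj}\otimes E_{jj}+\sum_{j<k}\Big(\frac{\theta(q^2\Pi^*_{j,k})\theta(q^{-2}\Pi^*_{j,k})\theta(z)}{\theta(\Pi^*_{j,k})^2}E_{jj}\otimes E_{kk}+\theta(z)E_{kk}\otimes E_{jj}+\frac{\theta(q^2)\theta(z\Pi^*_{j,k})}{\theta(\Pi^*_{j,k})}E_{jk}\otimes E_{kj}+\frac{\theta(q^2)\theta(z/\Pi^*_{j,k})}{\theta(1/\Pi^*_{j,k})}E_{kj}\otimes E_{jk}\Big)$. Tensor product of vector representations. Let $\widehat V=\bigoplus_{\mu=1}^N\mathbb Fv_\mu$, $w_1,\dots,w_n\in\mathbb C^\times$ generic, and $\mathcal V=\widehat V_{w_1}\widetilde\otimes\cdots\widetilde\otimes\widehat V_{w_n}$, the $\mathbb F$-vector space with basis $v_{\boldsymbol\mu}=v_{\mu_1}\widetilde\otimes\cdots\widetilde\otimes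 v_{\mu_n}$, $\boldsymbol\mu\in[1,N]^n$. Write $\widetilde R^{(0n)}(z/w_n,\Pi^*q^{2\sum_{j=1}^{n-1}h^{(j)}})\cdots\widetilde R^{(02)}(z/w_2,\Pi^*q^{2h^{(1)}})\widetilde R^{(01)}(z/w_1,\Pi^* )=\sum_{k,l}E_{kl}\otimes T_{kl}(z;\Pi^* )$, where $0$ labels an auxiliary copy of $\mathbb C^N$ and $q^{2h^{(i)}}$ multiplies $\Pi^*_{j,k}$ by $q^{2(\delta_{\beta j}-\delta_{\beta k})}$ on vectors with $v_\beta$ in the $i$-th tensor factor. The $L$-operators act by $L^+_{kl}(z)(f(P)v_{\boldsymbol\alpha})=f(P+\epsilon_l)\,T_{kl}(z;\Pi^* )v_{\boldsymbol\alpha}$, where $f(P+\epsilon_l)$ means $P_{\epsilon_i}\mapsto P_{\epsilon_i}+\delta_{il}$ (so $\Pi^*_{i,j}\mapsto\Pi^*_{i,j}q^{2(\delta_{li}-\delta_{lj})}$). Put $\zeta=v_{(1,\dots,1)}$. For $S=\{s_1<\dots<s_r\}$ put $L^+_{kl}(w_S)=L^+_{kl}(w_{s_r})\cdots L^+_{kl}(w_{s_1})$, and $\widetilde\xi_I=L^+_{N-1,N}(w_{I_N})L^+_{N-2,N-1}(w_{I_{N-1}\cup I_N})\cdots L^+_{12}(w_{I_2\cup\cdots\cup I_N})\zeta$. Partitions. For $\lambda=(\lambda_1,\dots,\lambda_N)$ with $\sum\lambda_l=n$, $\mathcal I_\lambda$ is the set of ordered partitions $I=(I_1,\dots,I_N)$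 of $[1,n]$ with $|I_l|=\lambda_l$. To $\boldsymbol\mu\in[1,N]^n$ corresponds $J_{\boldsymbol\mu}$ with $(J_{\boldsymbol\mu})_l=\{i:\mu_i=l\}$; $v_{J_{\boldsymbol\mu}}=v_{\boldsymbol\mu}$. Elliptic weight functions. For $J=J_{\boldsymbol\mu}\in\mathcal I_\lambda$ let $\lambda^{(l)}=\lambda_1+\cdots+\lambda_l$, $J_1\cup\cdots\cup J_l=\{i^{(l)}_1<\dots<i^{(l)}_{\lambda^{(l)}}\}$, variables $t^{(l)}_a$ $(1\le l\le N,1\le a\le\lambda^{(l)})$ with $t^{(N)}_a=w_a$. Then $\widetilde W_J(\mathbf t,\mathbf w,\Pi^* )=\mathrm{Sym}_{t^{(1)}}\cdots\mathrm{Sym}_{t^{(N-1)}}\widetilde U_J$ ($\mathrm{Sym}_{t^{(l)}}$ = sum over all permutations of $t^{(l)}_1,\dots,t^{(l)}_{\lambda^{(l)}}$), $$\widetilde U_J=\prod_{l=1}^{N-1}\prod_{a=1}^{\lambda^{(l)}}\Bigg(\frac{\theta(q^{-2C_{\mu_s,l+1}(s)}\Pi^*_{\mu_s,l+1}t^{(l+1)}_b/t^{(l)}_a)\theta(q^2)}{\theta(q^2t^{(l+1)}_b/t^{(l)}_a)\theta(q^{-2C_{\mu_s,l+1}(s)}\Pi^*_{\mu_s,l+1})}\Bigg|_{i^{(l+1)}_b=i^{(l)}_a=s}\prod_{b:\,i^{(l+1)}_b>i^{(l)}_a}\frac{\theta(t^{(l+1)}_b/t^{(l)}_a)}{\theta(q^2t^{(l+1)}_b/t^{(l)}_a)}\prod_{b=a+1}^{\lambda^{(l)}}\frac{\theta(q^{-2}t^{(l)}_a/t^{(l)}_b)}{\theta(t^{(l)}_a/t^{(l)}_b)}\Bigg),$$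 $C_{\mu_s,l+1}(s)=\sum_{j=s+1}^n(\delta_{\mu_j,\mu_s}-\delta_{\mu_j,l+1})$. The specialization $\mathbf t=\mathbf w_I$ sets $t^{(l)}_a=w_{i_a}$ where $I_1\cup\cdots\cup I_l=\{i_1<\dots<i_{\lambda^{(l)}}\}$. $\Pi^*q^{2\sum_j\langle\bar\epsilon_{\mu_j},h\rangle}$ means $\Pi^*_{k,l}\mapsto\Pi^*_{k,l}q^{2(\lambda_k-\lambda_l)}$. The vectors $\xi'_I$ ($I\in\mathcal I_\lambda$) are the Gelfand–Tsetlin vectors constructed in earlier work, for which it is known that $\xi'_I=\sum_{J\in\mathcal I_\lambda}\widetilde W_J(\mathbf w_I,\mathbf w,\Pi^*q^{2\sum_j\langle\bar\epsilon_{\mu_j},h\rangle})v_J$. The vectors $\widetilde\xi_I$ and $\xi'_I$ are proportional, and $N(\mathbf w)$ (depending on $I$) denotes the factor: $\widetilde\xi_I=N(\mathbf w)\xi'_I$. *)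

theory Defs
  imports
    "HOL-Complex_Analysis.Complex_Analysis"
    "HOL-Computational_Algebra.Fraction_Field"
    "HOL-Combinatorics.Permutations"
begin

section \<open>The odd theta function\<close>

definition qpoch_inf :: "complex \<Rightarrow> complex \<Rightarrow> complex" where
  "qpoch_inf x p = (\<Prod>n. 1 - x * p ^ n)"

definition Theta :: "complex \<Rightarrow> complex \<Rightarrow> complex" where
  "Theta p z = qpoch_inf z p * qpoch_inf (p / z) p * qpoch_inf p p"

text \<open>
  The function \<open>\<theta>(z) = - z\<^sup>-\<^sup>1\<^sup>/\<^sup>2 \<Theta>\<^sub>p(z)\<close> is two-valued in \<open>z\<close>. As usual it is read as a function of
  the additive variable \<open>u\<close> with \<open>z = exp u\<close>, and \<open>theta p u\<close> stands for \<open>\<theta>(exp u)\<close>. Logarithms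
  \<open>\<kappa>\<close> of \<open>q\<close> and \<open>\<omega> i\<close> of \<open>w\<^sub>i\<close> are fixed once and for all, products of arguments become sums, and
  for instance \<open>\<theta>(q\<^sup>2 w\<^sub>b / w\<^sub>a)\<close> is \<open>theta p (2 * \<kappa> + \<omega> b - \<omega> a)\<close>. With this reading
  \<open>\<theta>(1/z) = - \<theta>(z)\<close> holds without any branch ambiguity.
\<close>

definition theta :: "complex \<Rightarrow> complex \<Rightarrow> complex" where
  "theta p u = - exp (- u / 2) * Theta p (exp u)"

lemma qpoch_inf_limit:
  assumes "norm p < 1"
  shows "(\<lambda>n. \<Prod>k<n. 1 - x * p ^ k) \<longlonglongrightarrow> qpoch_inf x p"
proof -
  have "summable (\<lambda>k. norm ((1 - x * p ^ k) - 1))"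
    using assms by (auto simp: norm_mult norm_power intro!: summable_mult summable_geometric)
  hence "abs_convergent_prod (\<lambda>k. 1 - x * p ^ k)"
    by (rule summable_imp_abs_convergent_prod)
  hence "convergent_prod (\<lambda>k. 1 - x * p ^ k)"
    by (rule abs_convergent_prod_imp_convergent_prod)
  hence "(\<lambda>n. \<Prod>k\<le>n. 1 - x * p ^ k) \<longlonglongrightarrow> qpoch_inf x p"
    unfolding qpoch_inf_def by (rule convergent_prod_LIMSEQ)
  thus ?thesis
    by (subst filterlim_sequentially_Suc [symmetric]) (simp add: lessThan_Suc_atMost)
qed

lemma qpoch_inf_holomorphic:
  assumes p: "norm p < 1"
  shows "(\<lambda>x. qpoch_inf x p) holomorphic_on UNIV"
proof (rule holomorphic_uniform_sequence)
  show "(\<lambda>x. \<Prod>k<n. 1 - x * p ^ k) holomorphic_on UNIV" for n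
    by (intro holomorphic_intros)
next
  fix x :: complex
  let ?A = "cball x 1"
  have "uniformly_convergent_on ?A (\<lambda>n y. \<Prod>k<n. 1 - y * p ^ k)"
  proof (rule uniformly_convergent_on_prod')
    show "uniformly_convergent_on ?A (\<lambda>n y. \<Sum>k<n. norm (1 - y * p ^ k - 1))"
    proof (rule Weierstrass_m_test')
      show "norm (norm (1 - y * p ^ k - 1)) \<le> (norm x + 1) * norm p ^ k" if "y \<in> ?A" for k y
      proof -
        have "norm y \<le> norm x + 1"
          using that norm_triangle_ineq2[of y x] by (simp add: dist_norm norm_minus_commute)
        thus ?thesis
          by (simp add: norm_mult norm_power mult_right_mono)
      qed
      show "summable (\<lambda>k. (norm x + 1) * norm p ^ k)"
        using p by (intro summable_mult summable_geometric) auto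
    qed
  qed (auto intro!: continuous_intros)
  then obtain l where l: "uniform_limit ?A (\<lambda>n y. \<Prod>k<n. 1 - y * p ^ k) l sequentially"
    by (auto simp: uniformly_convergent_on_def)
  have "l y = qpoch_inf y p" if "y \<in> ?A" for y
    using tendsto_uniform_limitI[OF l that] qpoch_inf_limit[OF p] LIMSEQ_unique by blast
  hence "uniform_limit ?A (\<lambda>n y. \<Prod>k<n. 1 - y * p ^ k) (\<lambda>y. qpoch_inf y p) sequentially"
    using l uniform_limit_cong'[of ?A _ _ l] by (metis (no_types, lifting))
  thus "\<exists>d>0. cball x d \<subseteq> UNIV \<and>
      uniform_limit (cball x d) (\<lambda>n y. \<Prod>k<n. 1 - y * p ^ k) (\<lambda>y. qpoch_inf y p) sequentially"
    by (intro exI[of _ 1]) auto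
qed auto

lemma theta_holomorphic:
  assumes "norm p < 1"
  shows "theta p holomorphic_on UNIV"
proof -
  have *: "(\<lambda>u. qpoch_inf (f u) p) holomorphic_on UNIV" if "f holomorphic_on UNIV" for f
    using holomorphic_on_compose_gen[OF that qpoch_inf_holomorphic[OF assms]] by (simp add: o_def)
  show ?thesis
    unfolding theta_def Theta_def by (intro holomorphic_intros *) auto
qed


section \<open>The field of meromorphic functions of the dynamical variables\<close>

text \<open>
  A point \<open>P :: nat \<Rightarrow> complex\<close> lists the dynamical variables, \<open>P j\<close> being \<open>P\<^sub>\<epsilon>\<^sub>j\<close>. An entire function
  depends on finitely many of them only, is continuous and is holomorphic in each variable separately.
\<close>

definition entire_fun :: "((nat \<Rightarrow> complex) \<Rightarrow> complex) \<Rightarrow> bool" where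
  "entire_fun f \<longleftrightarrow>
     continuous_on UNIV f \<and>
     (\<forall>P i. (\<lambda>z. f (P(i := z))) holomorphic_on UNIV) \<and>
     (\<exists>A. finite A \<and> (\<forall>P Q. (\<forall>i\<in>A. P i = Q i) \<longrightarrow> f P = f Q))"

lemma entire_fun_const: "entire_fun (\<lambda>_. c)"
  by (auto simp: entire_fun_def)

lemma entire_fun_combine:
  assumes f: "entire_fun f" and g: "entire_fun g"
    and cont: "continuous_on UNIV (\<lambda>P. h (f P) (g P))"
    and hol: "\<And>F G. F holomorphic_on UNIV \<Longrightarrow> G holomorphic_on UNIV \<Longrightarrow>
                (\<lambda>z::complex. h (F z) (G z)) holomorphic_on UNIV"
  shows "entire_fun (\<lambda>P. h (f P) (g P))"
proof -
  obtain A where A: "finite A" "\<And>P Q. (\<forall>i\<in>A. P i = Q i) \<Longrightarrow> f P = f Q"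
    using f unfolding entire_fun_def by metis
  obtain B where B: "finite B" "\<And>P Q. (\<forall>i\<in>B. P i = Q i) \<Longrightarrow> g P = g Q"
    using g unfolding entire_fun_def by metis
  have "\<forall>P Q. (\<forall>i\<in>A \<union> B. P i = Q i) \<longrightarrow> h (f P) (g P) = h (f Q) (g Q)"
    using A(2) B(2) by (metis UnI1 UnI2)
  moreover have "finite (A \<union> B)"
    using A(1) B(1) by simp
  moreover have "(\<lambda>z. h (f (P(i := z))) (g (P(i := z)))) holomorphic_on UNIV" for P i
    using f g by (intro hol) (auto simp: entire_fun_def)
  ultimately show ?thesis
    unfolding entire_fun_def using cont by blast
qed

lemma entire_fun_continuous: "entire_fun f \<Longrightarrow> continuous_on UNIV f"
  by (simp add: entire_fun_def)

lemma entire_fun_add: "entire_fun f \<Longrightarrow> entire_fun g \<Longrightarrow> entire_fun (\<lambda>P. f P + g P)"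
  by (rule entire_fun_combine[of f g "\<lambda>x y. x + y"])
    (auto intro: continuous_on_add holomorphic_on_add entire_fun_continuous)

lemma entire_fun_diff: "entire_fun f \<Longrightarrow> entire_fun g \<Longrightarrow> entire_fun (\<lambda>P. f P - g P)"
  by (rule entire_fun_combine[of f g "\<lambda>x y. x - y"])
    (auto intro: continuous_on_diff holomorphic_on_diff entire_fun_continuous)

lemma entire_fun_mult: "entire_fun f \<Longrightarrow> entire_fun g \<Longrightarrow> entire_fun (\<lambda>P. f P * g P)"
  by (rule entire_fun_combine[of f g "\<lambda>x y. x * y"])
    (auto intro: continuous_on_mult holomorphic_on_mult entire_fun_continuous)

lemma entire_fun_uminus: "entire_fun f \<Longrightarrow> entire_fun (\<lambda>P. - f P)"
  using entire_fun_diff[OF entire_fun_const[of 0]] by simp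

lemma entire_fun_common_nonzero:
  assumes f: "entire_fun f" and g: "entire_fun g" and "f A \<noteq> 0" and "g B \<noteq> 0"
  shows "\<exists>C. f C \<noteq> 0 \<and> g C \<noteq> 0"
proof -
  obtain S where S: "finite S" "\<And>P Q. (\<forall>i\<in>S. P i = Q i) \<Longrightarrow> f P = f Q"
    using f unfolding entire_fun_def by metis
  have *: "\<exists>C. f C \<noteq> 0 \<and> g C \<noteq> 0"
    if "finite S" "\<forall>i. i \<notin> S \<longrightarrow> A i = B i" "f A \<noteq> 0" "g B \<noteq> 0" for S A B
    using that
  proof (induction S arbitrary: A B rule: finite_induct)
    case empty
    hence "A = B" by auto
    thus ?case using empty by auto
  next
    case (insert i S)
    have cnt: "countable {z. h (Q(i := z)) = 0}" if "entire_fun h" "h Q \<noteq> 0" for h Q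
    proof -
      have "(\<lambda>z. h (Q(i := z))) \<noteq> (\<lambda>_. 0)"
        using that(2) by (metis fun_upd_triv)
      thus ?thesis
        using that(1) holomorphic_countable_equal_UNIV[of "\<lambda>z. h (Q(i := z))" "\<lambda>_. 0"]
        by (auto simp: entire_fun_def)
    qed
    have "countable ({z. f (A(i := z)) = 0} \<union> {z. g (B(i := z)) = 0})"
      using cnt f g insert.prems by blast
    hence "{z. f (A(i := z)) = 0} \<union> {z. g (B(i := z)) = 0} \<noteq> UNIV"
      using uncountable_UNIV_complex by metis
    then obtain z where "f (A(i := z)) \<noteq> 0" "g (B(i := z)) \<noteq> 0"
      by blast
    moreover have "\<forall>k. k \<notin> S \<longrightarrow> (A(i := z)) k = (B(i := z)) k"
      using insert.prems(1) by auto
    ultimately show ?case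
      using insert.IH by blast
  qed
  define A' where "A' = (\<lambda>i. if i \<in> S then A i else B i)"
  have "f A' = f A" by (rule S) (auto simp: A'_def)
  with * [of S A' B] S(1) assms show ?thesis by (auto simp: A'_def)
qed

lemma entire_fun_theta:
  assumes "norm p < 1"
  shows "entire_fun (\<lambda>P. theta p (c + d * (P j - P k)))"
proof -
  have cont: "continuous_on UNIV (\<lambda>P :: nat \<Rightarrow> complex. c + d * (P j - P k))"
    by (intro continuous_intros continuous_on_product_coordinates)
  have "continuous_on UNIV (\<lambda>P. theta p (c + d * (P j - P k)))"
    using continuous_on_compose2[OF holomorphic_on_imp_continuous_on[OF theta_holomorphic[OF assms]] cont]
    by simp
  moreover have "(\<lambda>z. theta p (c + d * ((P(i := z)) j - (P(i := z)) k))) holomorphic_on UNIV" for P i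
  proof -
    have "(\<lambda>z. c + d * ((P(i := z)) j - (P(i := z)) k)) holomorphic_on UNIV"
      by (cases "i = j"; cases "i = k") (auto intro!: holomorphic_intros)
    from holomorphic_on_compose_gen[OF this theta_holomorphic[OF assms]] show ?thesis
      by (simp add: o_def)
  qed
  ultimately show ?thesis
    unfolding entire_fun_def by (intro conjI allI exI[of _ "{j, k}"]) auto
qed

lemma entire_fun_shift:
  assumes f: "entire_fun f"
  shows "entire_fun (\<lambda>P. f (P(l := P l + 1)))"
proof -
  have c: "continuous_on UNIV (\<lambda>P :: nat \<Rightarrow> complex. P(l := P l + 1))"
  proof (rule continuous_on_coordinatewise_then_product)
    show "continuous_on UNIV (\<lambda>P :: nat \<Rightarrow> complex. (P(l := P l + 1)) i)" for i
      by (cases "i = l") (auto intro!: continuous_intros continuous_on_product_coordinates)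
  qed
  have "continuous_on UNIV (\<lambda>P. f (P(l := P l + 1)))"
    using continuous_on_compose2[OF entire_fun_continuous[OF f] c] by simp
  moreover have "(\<lambda>z. f ((P(i := z))(l := (P(i := z)) l + 1))) holomorphic_on UNIV" for P i
  proof (cases "i = l")
    case True
    have "(\<lambda>z. f (P(l := z))) holomorphic_on UNIV"
      using f by (simp add: entire_fun_def)
    from holomorphic_on_compose_gen[of "\<lambda>z. z + 1" UNIV, OF _ this] show ?thesis
      using True by (simp add: o_def holomorphic_intros)
  next
    case False
    have "(\<lambda>z. f ((P(l := P l + 1))(i := z))) holomorphic_on UNIV"
      using f unfolding entire_fun_def by blast
    thus ?thesis
      using False by (simp add: fun_upd_twist)
  qed
  moreover have "\<exists>A. finite A \<and> (\<forall>P Q. (\<forall>i\<in>A. P i = Q i) \<longrightarrow>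
                   f (P(l := P l + 1)) = f (Q(l := Q l + 1)))"
  proof -
    obtain A where A: "finite A" "\<And>P Q. (\<forall>i\<in>A. P i = Q i) \<Longrightarrow> f P = f Q"
      using f unfolding entire_fun_def by metis
    show ?thesis
      using A(1) by (intro exI[of _ "insert l A"]) (auto intro!: A(2))
  qed
  ultimately show ?thesis
    unfolding entire_fun_def by blast
qed

typedef entire = "{f. entire_fun f}"
  using entire_fun_const by blast

setup_lifting type_definition_entire

instantiation entire :: idom
begin

lift_definition zero_entire :: entire is "\<lambda>_. 0" by (rule entire_fun_const)
lift_definition one_entire :: entire is "\<lambda>_. 1" by (rule entire_fun_const)
lift_definition plus_entire :: "entire \<Rightarrow> entire \<Rightarrow> entire" is "\<lambda>f g P. f P + g P"
  by (rule entire_fun_add)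
lift_definition minus_entire :: "entire \<Rightarrow> entire \<Rightarrow> entire" is "\<lambda>f g P. f P - g P"
  by (rule entire_fun_diff)
lift_definition uminus_entire :: "entire \<Rightarrow> entire" is "\<lambda>f P. - f P"
  by (rule entire_fun_uminus)
lift_definition times_entire :: "entire \<Rightarrow> entire \<Rightarrow> entire" is "\<lambda>f g P. f P * g P"
  by (rule entire_fun_mult)

instance
proof
  show "(0 :: entire) \<noteq> 1"
    by transfer (simp add: fun_eq_iff)
  show "a * b \<noteq> 0" if "a \<noteq> 0" "b \<noteq> 0" for a b :: entire
    using that by transfer (metis entire_fun_common_nonzero mult_eq_0_iff)
qed (transfer; simp add: fun_eq_iff algebra_simps)+

end

text \<open>
  Every meromorphic function on a complex affine space is a quotient of two entire functions (the
  Poincare problem is solvable there), so the field of meromorphic functions of finitely many of the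
  \<open>P\<^sub>\<epsilon>\<^sub>j\<close> is the fraction field of the entire ones. The type \<open>dyn_field\<close> is the union over \<open>N\<close> of
  these fields for the variables with index at most \<open>N\<close>.
\<close>

type_synonym dyn_field = "entire fract"

lift_definition const_entire :: "complex \<Rightarrow> entire" is "\<lambda>c _. c"
  by (rule entire_fun_const)

definition const_F :: "complex \<Rightarrow> dyn_field" where
  "const_F c = Fract (const_entire c) 1"

text \<open>The automorphism \<open>f(P) \<mapsto> f(P + \<epsilon>\<^sub>l)\<close>.\<close>

lift_definition shift_entire :: "nat \<Rightarrow> entire \<Rightarrow> entire" is "\<lambda>l f P. f (P(l := P l + 1))"
  by (rule entire_fun_shift)

lemma shift_entire_mult: "shift_entire l (f * g) = shift_entire l f * shift_entire l g"
  by transfer simp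

lemma shift_entire_1 [simp]: "shift_entire l 1 = 1"
  by transfer simp

lemma shift_entire_eq_0_iff [simp]: "shift_entire l f = 0 \<longleftrightarrow> f = 0"
proof
  show "shift_entire l f = 0 \<Longrightarrow> f = 0"
  proof transfer
    fix l and f :: "(nat \<Rightarrow> complex) \<Rightarrow> complex"
    assume "(\<lambda>P. f (P(l := P l + 1))) = (\<lambda>_. 0)"
    hence "f ((P(l := P l - 1))(l := (P(l := P l - 1)) l + 1)) = 0" for P
      by meson
    thus "f = (\<lambda>_. 0)"
      by (simp add: fun_eq_iff)
  qed
qed (transfer, simp)

lift_definition shift_F :: "nat \<Rightarrow> dyn_field \<Rightarrow> dyn_field"
  is "\<lambda>l x. (shift_entire l (fst x), shift_entire l (snd x))"
  by (simp add: shift_entire_mult [symmetric])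

lemma shift_F_Fract: "shift_F l (Fract f g) = Fract (shift_entire l f) (shift_entire l g)"
  by transfer simp

text \<open>
  \<open>theta_Pi p \<kappa> m u j k\<close> is \<open>\<theta>(exp u \<cdot> \<Pi>\<^sup>*\<^sub>j\<^sub>,\<^sub>k q\<^bsup>2(m\<^sub>j - m\<^sub>k)\<^esup>)\<close> as an element of the field, where \<open>q = exp \<kappa>\<close>.
  The integers \<open>m\<close> encode every dynamical argument of the form \<open>\<Pi>\<^sup>* q\<^bsup>2(...)\<^esup>\<close> that occurs below.
\<close>

definition theta_Pi ::
    "complex \<Rightarrow> complex \<Rightarrow> (nat \<Rightarrow> int) \<Rightarrow> complex \<Rightarrow> nat \<Rightarrow> nat \<Rightarrow> dyn_field" where
  "theta_Pi p \<kappa> m u j k =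
     Fract (Abs_entire (\<lambda>P. theta p (u + 2 * \<kappa> * (P j - P k + of_int (m j - m k))))) 1"

lemma Rep_entire_theta:
  assumes "norm p < 1"
  shows "Rep_entire (Abs_entire (\<lambda>P. theta p (u + 2 * \<kappa> * (P j - P k + of_int i)))) =
         (\<lambda>P. theta p (u + 2 * \<kappa> * (P j - P k + of_int i)))"
  using entire_fun_theta[OF assms, of "u + 2 * \<kappa> * of_int i" "2 * \<kappa>" j k]
  by (intro Abs_entire_inverse) (simp add: algebra_simps)


section \<open>The dynamical R-matrix and the tensor product of vector representations\<close>

definition unit_mat :: "nat \<Rightarrow> nat \<Rightarrow> nat \<Rightarrow> nat \<Rightarrow> dyn_field" where
  "unit_mat i j a b = of_bool (a = i \<and> b = j)"

text \<open>
  \<open>Rmat N p \<kappa> u m i \<mu> j \<nu>\<close> is the coefficient of \<open>E\<^sub>i\<^sub>j \<otimes> E\<^sub>\<mu>\<^sub>\<nu>\<close> in the matrix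
  with spectral parameter \<open>exp u\<close> and dynamical parameter \<open>\<Pi>\<^sup>* q\<^sup>2\<^sup>m\<close>; here \<open>1/\<Pi>\<^sup>*\<^sub>j\<^sub>,\<^sub>k = \<Pi>\<^sup>*\<^sub>k\<^sub>,\<^sub>j\<close>.
\<close>

definition Rmat ::
    "nat \<Rightarrow> complex \<Rightarrow> complex \<Rightarrow> complex \<Rightarrow> (nat \<Rightarrow> int) \<Rightarrow> nat \<Rightarrow> nat \<Rightarrow> nat \<Rightarrow> nat \<Rightarrow> dyn_field" where
  "Rmat N p \<kappa> u m i \<mu> j \<nu> =
     (\<Sum>a=1..N. const_F (theta p (2 * \<kappa> + u)) * (unit_mat a a i j * unit_mat a a \<mu> \<nu>)) +
     (\<Sum>a=1..N. \<Sum>b=a+1..N.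
        theta_Pi p \<kappa> m (2 * \<kappa>) a b * theta_Pi p \<kappa> m (- 2 * \<kappa>) a b * const_F (theta p u)
          / (theta_Pi p \<kappa> m 0 a b)\<^sup>2 * (unit_mat a a i j * unit_mat b b \<mu> \<nu>) +
        const_F (theta p u) * (unit_mat b b i j * unit_mat a a \<mu> \<nu>) +
        const_F (theta p (2 * \<kappa>)) * theta_Pi p \<kappa> m u a b
          / theta_Pi p \<kappa> m 0 a b * (unit_mat a b i j * unit_mat b a \<mu> \<nu>) +
        const_F (theta p (2 * \<kappa>)) * theta_Pi p \<kappa> m u b a
          / theta_Pi p \<kappa> m 0 b a * (unit_mat b a i j * unit_mat a b \<mu> \<nu>))"

text \<open>
  The multi-indices \<open>\<mu> \<in> [1,N]\<^sup>n\<close>. A vector of the tensor product is represented by its coordinates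
  \<open>x :: (nat \<Rightarrow> nat) \<Rightarrow> dyn_field\<close> with respect to the basis \<open>v\<^sub>\<mu>\<close>, and likewise a vector \<open>\<phi>\<close> of
  the tensor product with the auxiliary space by its coordinates \<open>\<phi> k \<mu>\<close>.
\<close>

definition multi_idx :: "nat \<Rightarrow> nat \<Rightarrow> (nat \<Rightarrow> nat) set" where
  "multi_idx N n = {1..n} \<rightarrow>\<^sub>E {1..N}"

text \<open>
  The matrix with auxiliary label \<open>0\<close> acting in the \<open>i\<close>-th factor, at \<open>z / w\<^sub>i\<close> and with dynamical
  argument \<open>\<Pi>\<^sup>* q\<^sup>2\<^sup>h\<close>, where \<open>h\<close> is the sum of the \<open>h\<^sup>(\<^sup>r\<^sup>)\<close> with \<open>r < i\<close>. Spectral parameter \<open>z = exp x\<close>.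
\<close>

definition R_site ::
    "nat \<Rightarrow> complex \<Rightarrow> complex \<Rightarrow> (nat \<Rightarrow> complex) \<Rightarrow> complex \<Rightarrow> nat \<Rightarrow>
     (nat \<Rightarrow> (nat \<Rightarrow> nat) \<Rightarrow> dyn_field) \<Rightarrow> nat \<Rightarrow> (nat \<Rightarrow> nat) \<Rightarrow> dyn_field" where
  "R_site N p \<kappa> \<omega> x i \<phi> = (\<lambda>k \<beta>. \<Sum>l=1..N. \<Sum>a=1..N.
     Rmat N p \<kappa> (x - \<omega> i) (\<lambda>j. int (card {r\<in>{1..<i}. \<beta> r = j})) k (\<beta> i) l a * \<phi> l (\<beta>(i := a)))"

definition monodromy ::
    "nat \<Rightarrow> nat \<Rightarrow> complex \<Rightarrow> complex \<Rightarrow> (nat \<Rightarrow> complex) \<Rightarrow> complex \<Rightarrow>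
     (nat \<Rightarrow> (nat \<Rightarrow> nat) \<Rightarrow> dyn_field) \<Rightarrow> nat \<Rightarrow> (nat \<Rightarrow> nat) \<Rightarrow> dyn_field" where
  "monodromy N n p \<kappa> \<omega> x \<phi> = fold (R_site N p \<kappa> \<omega> x) [1..<n+1] \<phi>"

text \<open>The coefficient of \<open>v\<^sub>\<beta>\<close> in \<open>T\<^sub>k\<^sub>l(z; \<Pi>\<^sup>*) v\<^sub>\<alpha>\<close>.\<close>

definition T_coeff ::
    "nat \<Rightarrow> nat \<Rightarrow> complex \<Rightarrow> complex \<Rightarrow> (nat \<Rightarrow> complex) \<Rightarrow> nat \<Rightarrow> nat \<Rightarrow> complex \<Rightarrow>
     (nat \<Rightarrow> nat) \<Rightarrow> (nat \<Rightarrow> nat) \<Rightarrow> dyn_field" where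
  "T_coeff N n p \<kappa> \<omega> k l x \<beta> \<alpha> =
     monodromy N n p \<kappa> \<omega> x (\<lambda>a \<gamma>. of_bool (a = l \<and> \<gamma> = \<alpha>)) k \<beta>"

definition L_op ::
    "nat \<Rightarrow> nat \<Rightarrow> complex \<Rightarrow> complex \<Rightarrow> (nat \<Rightarrow> complex) \<Rightarrow> nat \<Rightarrow> nat \<Rightarrow> complex \<Rightarrow>
     ((nat \<Rightarrow> nat) \<Rightarrow> dyn_field) \<Rightarrow> (nat \<Rightarrow> nat) \<Rightarrow> dyn_field" where
  "L_op N n p \<kappa> \<omega> k l x v =
     (\<lambda>\<beta>. \<Sum>\<alpha>\<in>multi_idx N n. shift_F l (v \<alpha>) * T_coeff N n p \<kappa> \<omega> k l x \<beta> \<alpha>)"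

text \<open>\<open>L\<^sup>+\<^sub>k\<^sub>l(w\<^sub>S)\<close>; the operator belonging to the smallest element of \<open>S\<close> acts first.\<close>

definition L_set ::
    "nat \<Rightarrow> nat \<Rightarrow> complex \<Rightarrow> complex \<Rightarrow> (nat \<Rightarrow> complex) \<Rightarrow> nat \<Rightarrow> nat \<Rightarrow> nat set \<Rightarrow>
     ((nat \<Rightarrow> nat) \<Rightarrow> dyn_field) \<Rightarrow> (nat \<Rightarrow> nat) \<Rightarrow> dyn_field" where
  "L_set N n p \<kappa> \<omega> k l S v =
     fold (\<lambda>s. L_op N n p \<kappa> \<omega> k l (\<omega> s)) (sorted_list_of_set S) v"

definition ordered_partition :: "nat \<Rightarrow> nat \<Rightarrow> (nat \<Rightarrow> nat set) \<Rightarrow> bool" where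
  "ordered_partition N n I \<longleftrightarrow> (\<Union>l\<in>{1..N}. I l) = {1..n} \<and> disjoint_family_on I {1..N}"

definition block_union :: "(nat \<Rightarrow> nat set) \<Rightarrow> nat \<Rightarrow> nat \<Rightarrow> nat set" where
  "block_union I a b = (\<Union>l\<in>{a..b}. I l)"

definition zeta :: "nat \<Rightarrow> (nat \<Rightarrow> nat) \<Rightarrow> dyn_field" where
  "zeta n = (\<lambda>\<beta>. of_bool (\<beta> = (\<lambda>i\<in>{1..n}. 1)))"

definition xi_tilde ::
    "nat \<Rightarrow> nat \<Rightarrow> complex \<Rightarrow> complex \<Rightarrow> (nat \<Rightarrow> complex) \<Rightarrow> (nat \<Rightarrow> nat set) \<Rightarrow>
     (nat \<Rightarrow> nat) \<Rightarrow> dyn_field" where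
  "xi_tilde N n p \<kappa> \<omega> I =
     fold (\<lambda>k. L_set N n p \<kappa> \<omega> k (k + 1) (block_union I (k + 1) N)) [1..<N] (zeta n)"


section \<open>Elliptic weight functions and Gelfand--Tsetlin vectors\<close>

text \<open>
  For \<open>J = J\<^sub>\<mu>\<close>: \<open>J_size n \<mu> l\<close> is \<open>\<lambda>\<^sup>(\<^sup>l\<^sup>)\<close> and \<open>J_elem n \<mu> l a\<close> is \<open>i\<^sup>(\<^sup>l\<^sup>)\<^sub>a\<close>. List positions start at
  0, the index \<open>a\<close> at 1.
\<close>

definition J_upto :: "nat \<Rightarrow> (nat \<Rightarrow> nat) \<Rightarrow> nat \<Rightarrow> nat set" where
  "J_upto n \<mu> l = {i\<in>{1..n}. \<mu> i \<in> {1..l}}"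

definition J_size :: "nat \<Rightarrow> (nat \<Rightarrow> nat) \<Rightarrow> nat \<Rightarrow> nat" where
  "J_size n \<mu> l = card (J_upto n \<mu> l)"

definition J_elem :: "nat \<Rightarrow> (nat \<Rightarrow> nat) \<Rightarrow> nat \<Rightarrow> nat \<Rightarrow> nat" where
  "J_elem n \<mu> l a = sorted_list_of_set (J_upto n \<mu> l) ! (a - 1)"

definition C_exp :: "nat \<Rightarrow> (nat \<Rightarrow> nat) \<Rightarrow> nat \<Rightarrow> nat \<Rightarrow> int" where
  "C_exp n \<mu> l s = (\<Sum>j=s+1..n. of_bool (\<mu> j = \<mu> s) - of_bool (\<mu> j = l))"

text \<open>
  The variables \<open>t\<^sup>(\<^sup>l\<^sup>)\<^sub>a\<close> enter through logarithms \<open>t l a\<close>, and the dynamical argument is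
  \<open>\<Pi>\<^sup>* q\<^sup>2\<^sup>m\<close>. The first product over \<open>b\<close> has exactly one factor, the \<open>b\<close> with \<open>i\<^sup>(\<^sup>l\<^sup>+\<^sup>1\<^sup>)\<^sub>b = i\<^sup>(\<^sup>l\<^sup>)\<^sub>a\<close>.
\<close>

definition U_weight ::
    "nat \<Rightarrow> nat \<Rightarrow> complex \<Rightarrow> complex \<Rightarrow> (nat \<Rightarrow> nat) \<Rightarrow> (nat \<Rightarrow> int) \<Rightarrow>
     (nat \<Rightarrow> nat \<Rightarrow> complex) \<Rightarrow> dyn_field" where
  "U_weight N n p \<kappa> \<mu> m t =
     (\<Prod>l=1..N-1. \<Prod>a=1..J_size n \<mu> l.
        (let s = J_elem n \<mu> l a; c = of_int (C_exp n \<mu> (l + 1) s) in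
         \<Prod>b\<in>{b\<in>{1..J_size n \<mu> (l + 1)}. J_elem n \<mu> (l + 1) b = s}.
           theta_Pi p \<kappa> m (- 2 * c * \<kappa> + t (l + 1) b - t l a) (\<mu> s) (l + 1) * const_F (theta p (2 * \<kappa>))
           / (const_F (theta p (2 * \<kappa> + t (l + 1) b - t l a)) *
              theta_Pi p \<kappa> m (- 2 * c * \<kappa>) (\<mu> s) (l + 1))) *
        (\<Prod>b\<in>{b\<in>{1..J_size n \<mu> (l + 1)}. J_elem n \<mu> (l + 1) b > J_elem n \<mu> l a}.
           const_F (theta p (t (l + 1) b - t l a) / theta p (2 * \<kappa> + t (l + 1) b - t l a))) *
        (\<Prod>b=a+1..J_size n \<mu> l.
           const_F (theta p (- 2 * \<kappa> + t l a - t l b) / theta p (t l a - t l b))))"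

definition Sym_level ::
    "nat \<Rightarrow> (nat \<Rightarrow> nat) \<Rightarrow> nat \<Rightarrow> ((nat \<Rightarrow> nat \<Rightarrow> complex) \<Rightarrow> dyn_field) \<Rightarrow>
     (nat \<Rightarrow> nat \<Rightarrow> complex) \<Rightarrow> dyn_field" where
  "Sym_level n \<mu> l f = (\<lambda>t. \<Sum>\<sigma> | \<sigma> permutes {1..J_size n \<mu> l}. f (t(l := t l \<circ> \<sigma>)))"

definition W_weight ::
    "nat \<Rightarrow> nat \<Rightarrow> complex \<Rightarrow> complex \<Rightarrow> (nat \<Rightarrow> nat) \<Rightarrow> (nat \<Rightarrow> int) \<Rightarrow>
     (nat \<Rightarrow> nat \<Rightarrow> complex) \<Rightarrow> (nat \<Rightarrow> complex) \<Rightarrow> dyn_field" where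
  "W_weight N n p \<kappa> \<mu> m t \<omega> =
     foldr (Sym_level n \<mu>) [1..<N] (U_weight N n p \<kappa> \<mu> m) (t(N := \<omega>))"

text \<open>The specialization \<open>t = w\<^sub>I\<close>, in logarithms.\<close>

definition specialize :: "(nat \<Rightarrow> complex) \<Rightarrow> (nat \<Rightarrow> nat set) \<Rightarrow> nat \<Rightarrow> nat \<Rightarrow> complex" where
  "specialize \<omega> I = (\<lambda>l a. \<omega> (sorted_list_of_set (block_union I 1 l) ! (a - 1)))"

text \<open>
  The Gelfand--Tsetlin vector \<open>\<xi>'\<^sub>I\<close>, through its known expansion in the \<open>v\<^sub>J\<close>: its coordinate at
  \<open>v\<^sub>\<mu>\<close> is the weight function if \<open>J\<^sub>\<mu>\<close> has the same block sizes \<open>\<lambda>\<close> as \<open>I\<close>, and 0 otherwise.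
\<close>

definition xi_GT ::
    "nat \<Rightarrow> nat \<Rightarrow> complex \<Rightarrow> complex \<Rightarrow> (nat \<Rightarrow> complex) \<Rightarrow> (nat \<Rightarrow> nat set) \<Rightarrow>
     (nat \<Rightarrow> nat) \<Rightarrow> dyn_field" where
  "xi_GT N n p \<kappa> \<omega> I = (\<lambda>\<mu>.
     if \<mu> \<in> multi_idx N n \<and> (\<forall>l\<in>{1..N}. card {i\<in>{1..n}. \<mu> i = l} = card (I l))
     then W_weight N n p \<kappa> \<mu> (\<lambda>l. int (card (I l))) (specialize \<omega> I) \<omega>
     else 0)"

end

theory Submission
  imports Defs
begin

text \<open>
  The scalar is read off from one coordinate. Expand \<open>xi_tilde\<close> and \<open>xi_GT\<close> of \<open>I\<close> in the basis \<open>v\<^sub>\<mu>\<close> and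
  let \<open>b\<close> be the multi-index with \<open>J\<^sub>b = I\<close>. Both coordinates at \<open>v\<^sub>b\<close> are products of theta functions
  without dynamical variables, and the factor is their quotient.

  For \<open>xi_GT\<close> the coordinate is the weight function of \<open>I\<close> at its own point \<open>w\<^sub>I\<close>. A permutation of the
  variables of level \<open>l\<close> other than the identity moves some variable to a smaller position. There
  it meets the equal variable of level \<open>l + 1\<close> in a numerator \<open>\<theta>(t\<^sub>b / t\<^sub>a)\<close>, and \<open>\<theta>(1) = 0\<close>. So the
  symmetrization reduces, level by level from the top, to its identity term
  (\<open>W_weight_eq_U_weight\<close>). In that term the dynamical factors are 1, and since \<open>\<theta>\<close> is odd the
  factors of pairs from the same level cancel, which leaves the quotients \<open>\<theta>(w\<^sub>b/w\<^sub>a) / \<theta>(q\<^sup>2 w\<^sub>b/w\<^sub>a)\<close>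
  over pairs \<open>a < b\<close> with \<open>a\<close> in an earlier block than \<open>b\<close> (\<open>U_weight_diagonal\<close>).

  For \<open>xi_tilde\<close>, \<open>L\<^sub>k\<^sub>,\<^sub>k\<^sub>+\<^sub>1(w\<^sub>s)\<close> is a sum over the histories of an auxiliary line which enters at the
  first site with label \<open>k + 1\<close> and leaves after the last one with label \<open>k\<close>. At each site the line either
  keeps its label or exchanges it with that of the site, and at the site \<open>s\<close> it must exchange, because the
  R-matrix at \<open>z = 1\<close> is a multiple of the flip. Hence for each \<open>j\<close> the number of labels above \<open>j\<close> on the first \<open>y\<close>
  sites and the line together is conserved (\<open>path_conservation\<close>). Order the multi-indices by these
  numbers. Suppose that \<open>\<tau>\<close> lies below the support of a vector and has the label \<open>k\<close> at \<open>s\<close>, labels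
  at most \<open>k\<close> after \<open>s\<close> and labels at most \<open>k + 1\<close> before. Then conservation puts \<open>\<tau>\<close> with \<open>s\<close> raised
  to \<open>k + 1\<close> below the support of the image, and only one term contributes to the coefficient
  there: the source \<open>\<tau>\<close> and the line that is \<open>k + 1\<close> up to \<open>s\<close> and \<open>k\<close> from there on
  (\<open>leading_term_L_op\<close>). Such a line never has a smaller label than the site it keeps its label at, so
  its weights are \<open>\<theta>(w\<^sub>s/w\<^sub>r)\<close>, \<open>\<theta>(q\<^sup>2 w\<^sub>s/w\<^sub>r)\<close> and \<open>\<theta>(q\<^sup>2)\<close>, which the shifts of \<open>P\<close> fix. Since the
  operators act in the order of increasing \<open>s\<close> and then of increasing \<open>k\<close>, the hypotheses on
  \<open>\<tau>\<close> hold at every step on the way from \<open>\<zeta>\<close> to \<open>v\<^sub>b\<close> (\<open>leading_term_xi_tilde\<close>).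
\<close>

section \<open>Constants and theta functions in the dynamical field\<close>

lemma Fract_1_eq_0_iff: "Fract a (1 :: 'a :: idom) = 0 \<longleftrightarrow> a = 0"
  unfolding Zero_fract_def by (subst eq_fract) auto

lemma const_F_mult: "const_F (a * b) = const_F a * const_F b"
proof -
  have "const_entire (a * b) = const_entire a * const_entire b" by transfer simp
  thus ?thesis by (simp add: const_F_def)
qed

lemma const_F_0 [simp]: "const_F 0 = 0"
proof -
  have "const_entire 0 = 0" by transfer simp
  thus ?thesis by (simp add: const_F_def fract_collapse)
qed

lemma const_F_1 [simp]: "const_F 1 = 1"
proof -
  have "const_entire 1 = 1" by transfer simp
  thus ?thesis by (simp add: const_F_def fract_collapse)
qed

lemma const_F_eq_0_iff [simp]: "const_F c = 0 \<longleftrightarrow> c = 0"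
proof
  assume "const_F c = 0"
  hence "const_entire c = 0" by (simp add: const_F_def Fract_1_eq_0_iff)
  thus "c = 0" by transfer (simp add: fun_eq_iff)
qed simp

lemma const_F_prod: "const_F (\<Prod>i\<in>A. f i) = (\<Prod>i\<in>A. const_F (f i))"
  by (induction A rule: infinite_finite_induct) (simp_all add: const_F_mult)

lemma shift_F_const_F [simp]: "shift_F l (const_F c) = const_F c"
proof -
  have "shift_entire l (const_entire c) = const_entire c" by transfer simp
  thus ?thesis by (simp add: const_F_def shift_F_Fract)
qed

lemma shift_F_0 [simp]: "shift_F l 0 = 0"
  using shift_F_const_F[of l 0] by (simp del: shift_F_const_F)

lemma qpoch_inf_rec:
  assumes "norm p < 1"
  shows "qpoch_inf x p = (1 - x) * qpoch_inf (x * p) p"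
proof -
  have "(\<lambda>n. (1 - x) * (\<Prod>k<n. 1 - x * p * p ^ k)) \<longlonglongrightarrow> (1 - x) * qpoch_inf (x * p) p"
    by (intro tendsto_intros qpoch_inf_limit assms)
  moreover have "(1 - x) * (\<Prod>k<n. 1 - x * p * p ^ k) = (\<Prod>k<Suc n. 1 - x * p ^ k)" for n
    by (simp only: prod.lessThan_Suc_shift) (simp add: mult.assoc)
  ultimately have "(\<lambda>n. \<Prod>k<Suc n. 1 - x * p ^ k) \<longlonglongrightarrow> (1 - x) * qpoch_inf (x * p) p"
    by simp
  moreover have "(\<lambda>n. \<Prod>k<Suc n. 1 - x * p ^ k) \<longlonglongrightarrow> qpoch_inf x p"
    using qpoch_inf_limit[OF assms] by (rule LIMSEQ_Suc)
  ultimately show ?thesis using LIMSEQ_unique by blast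
qed

lemma qpoch_inf_nonzero:
  assumes "norm p < 1" "\<And>n. x * p ^ n \<noteq> 1"
  shows "qpoch_inf x p \<noteq> 0"
proof -
  have "summable (\<lambda>k. norm ((1 - x * p ^ k) - 1))"
    using assms(1) by (auto simp: norm_mult norm_power intro!: summable_mult summable_geometric)
  hence "convergent_prod (\<lambda>k. 1 - x * p ^ k)"
    by (intro abs_convergent_prod_imp_convergent_prod summable_imp_abs_convergent_prod)
  thus ?thesis
    unfolding qpoch_inf_def using assms(2) by (intro prodinf_nonzero) (metis right_minus_eq)+
qed

lemma theta_0 [simp]: "norm p < 1 \<Longrightarrow> theta p 0 = 0"
  using qpoch_inf_rec[of p 1] by (simp add: theta_def Theta_def)

text \<open>
  Replacing \<open>z\<close> by \<open>1/z\<close> exchanges the infinite products of \<open>z\<close> and of \<open>p/z\<close> in \<open>\<Theta>\<^sub>p\<close>, up to the first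
  factor of each. The quotient \<open>(1 - 1/z) / (1 - z) = - 1/z\<close> of these two factors and the
  prefactor \<open>z\<^sup>-\<^sup>1\<^sup>/\<^sup>2\<close> combine to the sign.
\<close>

lemma theta_minus:
  assumes "norm p < 1"
  shows "theta p (- u) = - theta p u"
proof -
  have split: "exp (u / 2) = exp u * exp (- u / 2)"
    by (simp flip: exp_add)
  have "qpoch_inf (exp (- u)) p = (1 - exp (- u)) * qpoch_inf (p / exp u) p"
    using qpoch_inf_rec[OF assms, of "exp (- u)"] by (simp add: exp_minus field_simps)
  moreover have q2: "qpoch_inf (exp u) p = (1 - exp u) * qpoch_inf (p / exp (- u)) p"
    using qpoch_inf_rec[OF assms, of "exp u"] by (simp add: exp_minus field_simps)
  moreover have e: "exp u * (1 - exp (- u)) = - (1 - exp u)"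
    by (simp add: exp_minus field_simps)
  moreover have "exp (- (- u) / 2) = exp u * exp (- u / 2)"
    using split by simp
  ultimately have "theta p (- u) = - (exp u * (1 - exp (- u))) * exp (- u / 2) *
      (qpoch_inf (p / exp u) p * qpoch_inf (p / exp (- u)) p * qpoch_inf p p)"
    unfolding theta_def Theta_def by algebra
  also have "\<dots> = (1 - exp u) * exp (- u / 2) *
      (qpoch_inf (p / exp u) p * qpoch_inf (p / exp (- u)) p * qpoch_inf p p)"
    by (simp only: e minus_minus)
  also have "\<dots> = - theta p u"
    unfolding theta_def Theta_def q2 by algebra
  finally show ?thesis .
qed

lemma theta_nonzero:
  assumes p: "p \<noteq> 0" "norm p < 1" and u: "\<And>b::int. exp u \<noteq> p powi b"
  shows "theta p u \<noteq> 0"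
proof -
  have "exp u * p ^ m \<noteq> 1" for m
    using u[of "- int m"] p(1) by (auto simp: power_int_minus field_simps)
  moreover have "p / exp u * p ^ m \<noteq> 1" for m
    using u[of "int (Suc m)"] p(1) by (auto simp: field_simps simp del: of_nat_Suc)
  moreover have "p * p ^ m \<noteq> 1" for m
  proof
    assume "p * p ^ m = 1"
    hence "norm (p ^ Suc m) = 1" by simp
    hence "norm p ^ Suc m = 1" by (simp only: norm_power)
    moreover have "norm p ^ Suc m < 1" using p by (intro power_Suc_less_one) auto
    ultimately show False by simp
  qed
  ultimately show ?thesis
    unfolding theta_def Theta_def using p(2) by (simp add: qpoch_inf_nonzero)
qed

text \<open>
  The argument runs through all of the complex plane as \<open>P\<^sub>j\<close> varies, because \<open>j \<noteq> k\<close> and \<open>\<kappa> \<noteq> 0\<close>. A single point \<open>c\<close>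
  where \<open>\<theta>\<close> does not vanish is therefore enough.
\<close>

lemma theta_Pi_nonzero:
  assumes p: "norm p < 1" and \<kappa>: "\<kappa> \<noteq> 0" and jk: "j \<noteq> k" and c: "theta p c \<noteq> 0"
  shows "theta_Pi p \<kappa> m u j k \<noteq> 0"
proof
  let ?f = "\<lambda>P. theta p (u + 2 * \<kappa> * (P j - P k + of_int (m j - m k)))"
  assume "theta_Pi p \<kappa> m u j k = 0"
  hence "Abs_entire ?f = 0"
    unfolding theta_Pi_def Fract_1_eq_0_iff .
  hence "Rep_entire (Abs_entire ?f) = Rep_entire 0"
    by (rule arg_cong)
  hence "?f = (\<lambda>_. 0)"
    unfolding Rep_entire_theta[OF p] zero_entire.rep_eq .
  hence zero: "?f P = 0" for P by (rule fun_cong)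
  define P :: "nat \<Rightarrow> complex"
    where "P = (\<lambda>_. 0)(j := (c - u) / (2 * \<kappa>) - of_int (m j - m k))"
  have "u + 2 * \<kappa> * (P j - P k + of_int (m j - m k)) = c"
    using jk \<kappa> by (simp add: P_def)
  with zero[of P] c show False
    by (simp only:)
qed


section \<open>Entries of the R-matrix\<close>

lemma sum_upper_triangle_single:
  fixes g :: "nat \<Rightarrow> nat \<Rightarrow> 'a :: comm_monoid_add"
  assumes "1 \<le> a0" "a0 < b0" "b0 \<le> N"
    and zero: "\<And>a b. a < b \<Longrightarrow> (a, b) \<noteq> (a0, b0) \<Longrightarrow> g a b = 0"
  shows "(\<Sum>a=1..N. \<Sum>b=a+1..N. g a b) = g a0 b0"
proof -
  have "(\<Sum>b=a0+1..N. g a0 b) = (\<Sum>b\<in>{b0}. g a0 b)"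
    using assms by (intro sum.mono_neutral_right) auto
  moreover have "(\<Sum>a=1..N. \<Sum>b=a+1..N. g a b) = (\<Sum>a\<in>{a0}. \<Sum>b=a+1..N. g a b)"
    using assms(1-3) by (intro sum.mono_neutral_right) (auto intro!: sum.neutral zero)
  ultimately show ?thesis by simp
qed

lemma add_zeros: "a = 0 \<Longrightarrow> b = 0 \<Longrightarrow> a + b = (0 :: 'a :: monoid_add)"
  by simp

lemma Rmat_ice_rule:
  assumes "Rmat N p \<kappa> u m k b l a \<noteq> 0"
  shows "(k = l \<and> b = a) \<or> (k = a \<and> b = l)"
proof (rule ccontr)
  assume *: "\<not> ?thesis"
  have "Rmat N p \<kappa> u m k b l a = 0"
    unfolding Rmat_def
    by (intro add_zeros sum.neutral ballI) (use * in \<open>auto simp: unit_mat_def\<close>)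
  with assms show False by simp
qed

lemma Rmat_same:
  assumes "c \<in> {1..N}"
  shows "Rmat N p \<kappa> u m c c c c = const_F (theta p (2 * \<kappa> + u))"
proof -
  have "(\<Sum>x=1..N. const_F (theta p (2 * \<kappa> + u)) * (unit_mat x x c c * unit_mat x x c c)) =
        (\<Sum>x\<in>{c}. const_F (theta p (2 * \<kappa> + u)) * (unit_mat x x c c * unit_mat x x c c))"
    using assms by (intro sum.mono_neutral_right) (auto simp: unit_mat_def)
  thus ?thesis
    unfolding Rmat_def by (simp add: unit_mat_def) (auto intro!: sum.neutral)
qed

text \<open>
  A line with the larger label meets a site with the smaller one. The R-matrix is normalized so that this diagonal entry
  is free of dynamical variables; the one with the roles exchanged is not.
\<close>

lemma Rmat_pass:
  assumes "1 \<le> a" "a < c" "c \<le> N"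
  shows "Rmat N p \<kappa> u m c a c a = const_F (theta p u)"
  unfolding Rmat_def
  by (subst sum_upper_triangle_single[of a c])
     (use assms in \<open>auto simp: unit_mat_def intro!: sum.neutral\<close>)

lemma Rmat_at_0_swap:
  assumes "norm p < 1" "\<kappa> \<noteq> 0" "theta p (2 * \<kappa>) \<noteq> 0" and "1 \<le> a" "a < c" "c \<le> N"
  shows "Rmat N p \<kappa> 0 m a c c a = const_F (theta p (2 * \<kappa>))"
proof -
  have "theta_Pi p \<kappa> m 0 a c \<noteq> 0"
    using assms by (intro theta_Pi_nonzero[where c = "2 * \<kappa>"]) auto
  thus ?thesis
    unfolding Rmat_def
    by (subst sum_upper_triangle_single[of a c])
       (use assms in \<open>auto simp: unit_mat_def intro!: sum.neutral\<close>)
qed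

text \<open>
  At \<open>z = 1\<close> only the flip survives, because \<open>\<theta>(1) = 0\<close>. This is what forces the exchange at the site \<open>s\<close>
  when the spectral parameter is \<open>w\<^sub>s\<close>.
\<close>

lemma Rmat_at_0:
  assumes "norm p < 1" "Rmat N p \<kappa> 0 m k b l a \<noteq> 0"
  shows "k = a \<and> b = l"
proof (rule ccontr)
  assume "\<not> ?thesis"
  with Rmat_ice_rule[OF assms(2)] have *: "k = l" "b = a" "k \<noteq> a" by auto
  have "Rmat N p \<kappa> 0 m k b l a = 0"
    unfolding Rmat_def
    by (intro add_zeros sum.neutral ballI) (use * assms(1) in \<open>auto simp: unit_mat_def\<close>)
  with assms(2) show False by simp
qed


section \<open>The monodromy as a sum over histories of the auxiliary line\<close>

text \<open>
  With source \<open>\<alpha>\<close> and target \<open>\<beta>\<close> fixed, the only freedom left in the monodromy is the label of the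
  auxiliary line. \<open>aux_amplitude N p \<kappa> \<omega> x l \<alpha> \<beta> i c\<close> is the total weight of all ways for the line
  to enter with \<open>l\<close> and to carry \<open>c\<close> after the site \<open>i\<close>.
\<close>

primrec aux_amplitude ::
    "nat \<Rightarrow> complex \<Rightarrow> complex \<Rightarrow> (nat \<Rightarrow> complex) \<Rightarrow> complex \<Rightarrow> nat \<Rightarrow>
     (nat \<Rightarrow> nat) \<Rightarrow> (nat \<Rightarrow> nat) \<Rightarrow> nat \<Rightarrow> nat \<Rightarrow> dyn_field" where
  "aux_amplitude N p \<kappa> \<omega> x l \<alpha> \<beta> 0 = (\<lambda>k. of_bool (k = l))"
| "aux_amplitude N p \<kappa> \<omega> x l \<alpha> \<beta> (Suc i) = (\<lambda>k. \<Sum>c=1..N.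
     Rmat N p \<kappa> (x - \<omega> (Suc i)) (\<lambda>j. int (card {r\<in>{1..<Suc i}. \<beta> r = j})) k (\<beta> (Suc i)) c (\<alpha> (Suc i))
       * aux_amplitude N p \<kappa> \<omega> x l \<alpha> \<beta> i c)"

lemma aux_amplitude_cong:
  assumes "\<And>r. r \<in> {1..i} \<Longrightarrow> \<beta> r = \<beta>' r"
  shows "aux_amplitude N p \<kappa> \<omega> x l \<alpha> \<beta> i = aux_amplitude N p \<kappa> \<omega> x l \<alpha> \<beta>' i"
  using assms
proof (induction i)
  case (Suc i)
  have "{r\<in>{1..<Suc i}. \<beta> r = j} = {r\<in>{1..<Suc i}. \<beta>' r = j}" for j
    using Suc.prems by auto
  moreover have "\<beta> (Suc i) = \<beta>' (Suc i)"
    using Suc.prems by simp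
  ultimately show ?case
    using Suc by simp
qed simp

text \<open>
  The operator of a site changes the multi-index at that site only, and its dynamical argument looks at
  earlier sites of the target. So the site \<open>i\<close> still has its source label \<open>\<alpha> i\<close> when the operator
  reaches it, and the sum over intermediate multi-indices collapses.
\<close>

lemma fold_R_site_eq_aux_amplitude:
  assumes "\<And>r. r \<in> {1..i} \<Longrightarrow> \<alpha> r \<in> {1..N}"
  shows "fold (R_site N p \<kappa> \<omega> x) [1..<i+1] (\<lambda>a \<gamma>. of_bool (a = l \<and> \<gamma> = \<alpha>)) k \<beta> =
         (if \<forall>r. r \<notin> {1..i} \<longrightarrow> \<beta> r = \<alpha> r then aux_amplitude N p \<kappa> \<omega> x l \<alpha> \<beta> i k else 0)"
  using assms
proof (induction i arbitrary: k \<beta>)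
  case 0
  have "(\<forall>r. \<beta> r = \<alpha> r) \<longleftrightarrow> \<beta> = \<alpha>" by auto
  thus ?case by simp
next
  case (Suc i)
  let ?F = "fold (R_site N p \<kappa> \<omega> x) [1..<i+1] (\<lambda>a \<gamma>. of_bool (a = l \<and> \<gamma> = \<alpha>))"
  let ?R = "\<lambda>c a. Rmat N p \<kappa> (x - \<omega> (Suc i)) (\<lambda>j. int (card {r\<in>{1..<Suc i}. \<beta> r = j})) k (\<beta> (Suc i)) c a"
  let ?A = "aux_amplitude N p \<kappa> \<omega> x l \<alpha> \<beta>"
  let ?ok = "\<forall>r. r \<notin> {1..Suc i} \<longrightarrow> \<beta> r = \<alpha> r"
  have IH: "?F c (\<beta>(Suc i := a)) = (if a = \<alpha> (Suc i) then if ?ok then ?A i c else 0 else 0)" for c a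
  proof -
    have "(\<forall>r. r \<notin> {1..i} \<longrightarrow> (\<beta>(Suc i := a)) r = \<alpha> r) \<longleftrightarrow> a = \<alpha> (Suc i) \<and> ?ok"
      by (force simp: le_Suc_eq)
    moreover have "aux_amplitude N p \<kappa> \<omega> x l \<alpha> (\<beta>(Suc i := a)) i = ?A i"
      by (intro aux_amplitude_cong) auto
    moreover have "?F c (\<beta>(Suc i := a)) =
        (if \<forall>r. r \<notin> {1..i} \<longrightarrow> (\<beta>(Suc i := a)) r = \<alpha> r
         then aux_amplitude N p \<kappa> \<omega> x l \<alpha> (\<beta>(Suc i := a)) i c else 0)"
      using Suc.prems by (intro Suc.IH) auto
    ultimately show ?thesis
      by (simp only: if_if_eq_conj)
  qed
  have pull_if: "(\<Sum>c=1..N. f c * (if Q then g c else 0)) = (if Q then \<Sum>c=1..N. f c * g c else 0)"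
    for Q and f g :: "nat \<Rightarrow> dyn_field"
    by simp
  have "\<alpha> (Suc i) \<in> {1..N}" using Suc.prems by simp
  have "[1..<Suc i + 1] = [1..<i+1] @ [Suc i]" by simp
  hence "fold (R_site N p \<kappa> \<omega> x) [1..<Suc i + 1] (\<lambda>a \<gamma>. of_bool (a = l \<and> \<gamma> = \<alpha>)) k \<beta> =
      R_site N p \<kappa> \<omega> x (Suc i) ?F k \<beta>"
    by (simp only: fold_append o_apply fold_simps)
  also have "\<dots> = (\<Sum>c=1..N. \<Sum>a=1..N. ?R c a * (if a = \<alpha> (Suc i) then if ?ok then ?A i c else 0 else 0))"
    unfolding R_site_def IH ..
  also have "\<dots> = (\<Sum>c=1..N. ?R c (\<alpha> (Suc i)) * (if ?ok then ?A i c else 0))"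
  proof (intro sum.cong refl)
    fix c
    have "(\<Sum>a=1..N. ?R c a * (if a = \<alpha> (Suc i) then if ?ok then ?A i c else 0 else 0)) =
          (\<Sum>a=1..N. if a = \<alpha> (Suc i) then ?R c a * (if ?ok then ?A i c else 0) else 0)"
      by (intro sum.cong) auto
    also have "\<dots> = ?R c (\<alpha> (Suc i)) * (if ?ok then ?A i c else 0)"
      using \<open>\<alpha> (Suc i) \<in> {1..N}\<close> by (subst sum.delta) auto
    finally show "(\<Sum>a=1..N. ?R c a * (if a = \<alpha> (Suc i) then if ?ok then ?A i c else 0 else 0)) = \<dots>" .
  qed
  also have "\<dots> = (if ?ok then ?A (Suc i) k else 0)"
    unfolding aux_amplitude.simps by (rule pull_if)
  finally show ?case .
qed

lemma T_coeff_eq_aux_amplitude: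
  assumes "\<alpha> \<in> multi_idx N n" "\<beta> \<in> multi_idx N n"
  shows "T_coeff N n p \<kappa> \<omega> k l x \<beta> \<alpha> = aux_amplitude N p \<kappa> \<omega> x l \<alpha> \<beta> n k"
proof -
  have "\<alpha> r \<in> {1..N}" if "r \<in> {1..n}" for r
    using assms(1) that unfolding multi_idx_def by (rule PiE_mem)
  moreover have "\<beta> r = \<alpha> r" if "r \<notin> {1..n}" for r
    using assms that by (metis PiE_arb multi_idx_def)
  ultimately show ?thesis
    unfolding T_coeff_def monodromy_def by (subst fold_R_site_eq_aux_amplitude) auto
qed

text \<open>
  A nonzero sum contains a nonzero term, which is one history \<open>a\<close> of the line. Its nonzero entries of the
  R-matrix restrict each vertex to the two alternatives listed, the first of them being excluded at
  \<open>z = 1\<close>.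
\<close>

lemma aux_amplitude_path:
  assumes p: "norm p < 1" and "aux_amplitude N p \<kappa> \<omega> x l \<alpha> \<beta> i k \<noteq> 0"
  obtains a where "a 0 = l" "a i = k"
    "\<forall>r<i. (x \<noteq> \<omega> (Suc r) \<and> a (Suc r) = a r \<and> \<beta> (Suc r) = \<alpha> (Suc r))
                   \<or> (a (Suc r) = \<alpha> (Suc r) \<and> \<beta> (Suc r) = a r)"
  using assms(2)
proof (induction i arbitrary: k thesis)
  case 0
  thus ?case by (auto intro: 0(1)[of "\<lambda>_. l"] split: if_splits)
next
  case (Suc i)
  from Suc.prems(2) obtain c m where
    R: "Rmat N p \<kappa> (x - \<omega> (Suc i)) m k (\<beta> (Suc i)) c (\<alpha> (Suc i)) \<noteq> 0"
    and A: "aux_amplitude N p \<kappa> \<omega> x l \<alpha> \<beta> i c \<noteq> 0"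
    by (auto elim!: sum.not_neutral_contains_not_neutral)
  obtain a where a: "a 0 = l" "a i = c" and step:
    "\<forall>r<i. (x \<noteq> \<omega> (Suc r) \<and> a (Suc r) = a r \<and> \<beta> (Suc r) = \<alpha> (Suc r))
                   \<or> (a (Suc r) = \<alpha> (Suc r) \<and> \<beta> (Suc r) = a r)"
    using Suc.IH[OF _ A] by blast
  have new: "(x \<noteq> \<omega> (Suc i) \<and> k = c \<and> \<beta> (Suc i) = \<alpha> (Suc i)) \<or> (k = \<alpha> (Suc i) \<and> \<beta> (Suc i) = c)"
    using Rmat_ice_rule[OF R] Rmat_at_0[OF p] R by (cases "x = \<omega> (Suc i)") auto
  show ?case
  proof (rule Suc.prems(1)[of "a(Suc i := k)"], goal_cases)
    case 3
    show ?case
    proof (intro allI impI)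
      fix r assume "r < Suc i"
      thus "(x \<noteq> \<omega> (Suc r) \<and> (a(Suc i := k)) (Suc r) = (a(Suc i := k)) r \<and> \<beta> (Suc r) = \<alpha> (Suc r))
          \<or> ((a(Suc i := k)) (Suc r) = \<alpha> (Suc r) \<and> \<beta> (Suc r) = (a(Suc i := k)) r)"
        using new step a(2) by (cases "r = i") auto
    qed
  qed (use a in auto)
qed

definition count_above :: "(nat \<Rightarrow> nat) \<Rightarrow> nat \<Rightarrow> nat \<Rightarrow> nat" where
  "count_above \<mu> j y = card {i\<in>{1..y}. \<mu> i > j}"

lemma count_above_0 [simp]: "count_above \<mu> j 0 = 0"
  by (simp add: count_above_def)

lemma count_above_Suc [simp]:
  "count_above \<mu> j (Suc y) = count_above \<mu> j y + of_bool (\<mu> (Suc y) > j)"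
proof -
  have "{i\<in>{1..Suc y}. \<mu> i > j} = {i\<in>{1..y}. \<mu> i > j} \<union> (if \<mu> (Suc y) > j then {Suc y} else {})"
    by (auto simp: le_Suc_eq)
  thus ?thesis
    by (auto simp: count_above_def card_Un_disjoint)
qed

lemma count_above_mono: "x \<le> y \<Longrightarrow> count_above \<mu> j x \<le> count_above \<mu> j y"
  unfolding count_above_def by (intro card_mono) auto

lemma count_above_fun_upd:
  "count_above (\<mu>(s := c)) j y + of_bool (1 \<le> s \<and> s \<le> y \<and> \<mu> s > j) =
   count_above \<mu> j y + of_bool (1 \<le> s \<and> s \<le> y \<and> c > j)"
  by (induction y) (auto simp: le_Suc_eq)

text \<open>
  Every vertex preserves the pair formed by the label of the line and the label of the site, up to order. Summing over the
  first \<open>y\<close> sites gives a conservation law for each threshold \<open>j\<close>.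
\<close>

lemma path_conservation:
  assumes "a 0 = l" and step:
    "\<And>r. r < n \<Longrightarrow> (a (Suc r) = a r \<and> \<beta> (Suc r) = \<alpha> (Suc r))
                   \<or> (a (Suc r) = \<alpha> (Suc r) \<and> \<beta> (Suc r) = a r)"
    and "y \<le> n"
  shows "count_above \<beta> j y + of_bool (a y > j) = count_above \<alpha> j y + of_bool (l > j)"
  using \<open>y \<le> n\<close>
proof (induction y)
  case (Suc y)
  thus ?case using step[of y] by auto
qed (simp add: assms(1))


text \<open>
  The weight at the site \<open>r\<close> of the line that is \<open>k + 1\<close> before \<open>s\<close> and \<open>k\<close> after it. A site with the label of the
  line gives \<open>\<theta>(q\<^sup>2 w\<^sub>s/w\<^sub>r)\<close>, one with a smaller label gives \<open>\<theta>(w\<^sub>s/w\<^sub>r)\<close>, and the exchange at \<open>s\<close>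
  gives \<open>\<theta>(q\<^sup>2)\<close>.
\<close>

definition site_factor ::
    "complex \<Rightarrow> complex \<Rightarrow> (nat \<Rightarrow> complex) \<Rightarrow> nat \<Rightarrow> nat \<Rightarrow> (nat \<Rightarrow> nat) \<Rightarrow> nat \<Rightarrow> complex" where
  "site_factor p \<kappa> \<omega> k s \<tau> r =
     (if r = s then theta p (2 * \<kappa>)
      else if \<tau> r = (if r < s then k + 1 else k) then theta p (2 * \<kappa> + \<omega> s - \<omega> r)
      else theta p (\<omega> s - \<omega> r))"

text \<open>
  Off \<open>s\<close> source and target agree, so by the ice rule the line keeps its label there; at \<open>s\<close> the labels of
  source and target force it to turn from \<open>k + 1\<close> into \<open>k\<close>. Thus there is a single history, and the bounds
  on \<open>\<tau>\<close> ensure that the line carries the larger label at each site where the two labels differ.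
\<close>

lemma aux_amplitude_straight_path:
  assumes gen: "norm p < 1" "\<kappa> \<noteq> 0" "theta p (2 * \<kappa>) \<noteq> 0"
    and k: "1 \<le> k" "k < N" and s: "1 \<le> s" "s \<le> n"
    and \<tau>: "\<And>r. r \<in> {1..n} \<Longrightarrow> 1 \<le> \<tau> r" "\<And>r. r \<in> {1..n} \<Longrightarrow> \<tau> r \<le> k + 1"
      "\<And>r. r \<in> {s..n} \<Longrightarrow> \<tau> r \<le> k" "\<tau> s = k"
    and "i \<le> n"
  shows "aux_amplitude N p \<kappa> \<omega> (\<omega> s) (k + 1) \<tau> (\<tau>(s := k + 1)) i c =
     of_bool (c = (if i < s then k + 1 else k)) * const_F (\<Prod>r=1..i. site_factor p \<kappa> \<omega> k s \<tau> r)"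
  using \<open>i \<le> n\<close>
proof (induction i arbitrary: c)
  case 0
  thus ?case using s by auto
next
  case (Suc i)
  let ?\<beta> = "\<tau>(s := k + 1)"
  define a where "a = (if i < s then k + 1 else k)"
  define a' where "a' = (if Suc i < s then k + 1 else k)"
  define m where "m = (\<lambda>j. int (card {r\<in>{1..<Suc i}. ?\<beta> r = j}))"
  define R where "R = (\<lambda>c. Rmat N p \<kappa> (\<omega> s - \<omega> (Suc i)) m c (?\<beta> (Suc i)) a (\<tau> (Suc i)))"
  have \<tau>S: "1 \<le> \<tau> (Suc i)" "\<tau> (Suc i) \<le> k + 1" "s \<le> Suc i \<Longrightarrow> \<tau> (Suc i) \<le> k"
    using \<tau> Suc.prems by auto
  have R: "R c = of_bool (c = a') * const_F (site_factor p \<kappa> \<omega> k s \<tau> (Suc i))" for c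
  proof (cases "c = a'")
    case False
    hence "\<not> ((c = a \<and> ?\<beta> (Suc i) = \<tau> (Suc i)) \<or> (c = \<tau> (Suc i) \<and> ?\<beta> (Suc i) = a))"
      using \<tau>(4) by (auto simp: a_def a'_def)
    thus ?thesis
      using False Rmat_ice_rule unfolding R_def by fastforce
  next
    case True
    consider "Suc i < s" | "Suc i = s" | "s < Suc i" by linarith
    thus ?thesis
    proof cases
      case 1
      thus ?thesis
        using True \<tau>S k Rmat_same[of "k + 1" N] Rmat_pass[of "\<tau> (Suc i)" "k + 1" N]
        by (cases "\<tau> (Suc i) = k + 1") (auto simp: R_def a_def a'_def site_factor_def add_diff_eq)
    next
      case 2
      thus ?thesis
        using True \<tau>(4) k Rmat_at_0_swap[OF gen, of k "k + 1" N]
        by (auto simp: R_def a_def a'_def site_factor_def)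
    next
      case 3
      thus ?thesis
        using True \<tau>S k Rmat_same[of k N] Rmat_pass[of "\<tau> (Suc i)" k N]
        by (cases "\<tau> (Suc i) = k") (auto simp: R_def a_def a'_def site_factor_def add_diff_eq)
    qed
  qed
  have "a \<in> {1..N}" using k by (auto simp: a_def)
  let ?P = "const_F (\<Prod>r=1..i. site_factor p \<kappa> \<omega> k s \<tau> r)"
  have "aux_amplitude N p \<kappa> \<omega> (\<omega> s) (k + 1) \<tau> ?\<beta> (Suc i) c =
      (\<Sum>d=1..N. Rmat N p \<kappa> (\<omega> s - \<omega> (Suc i)) m c (?\<beta> (Suc i)) d (\<tau> (Suc i)) * (of_bool (d = a) * ?P))"
    using Suc by (simp only: aux_amplitude.simps Suc_leD m_def a_def)
  also have "\<dots> = (\<Sum>d=1..N. if d = a then R c * ?P else 0)"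
    by (intro sum.cong) (auto simp: R_def)
  also have "\<dots> = R c * ?P"
    using \<open>a \<in> {1..N}\<close> by (subst sum.delta) auto
  also have "\<dots> = of_bool (c = a') * const_F (\<Prod>r=1..Suc i. site_factor p \<kappa> \<omega> k s \<tau> r)"
    by (simp add: R const_F_mult mult_ac)
  finally show ?case
    by (simp only: a'_def)
qed


section \<open>Leading terms\<close>

text \<open>
  Above every threshold \<open>j\<close>, \<open>\<tau>\<close> and \<open>\<mu>\<close> have equally many labels, and those of \<open>\<mu>\<close> stand weakly to
  the left of those of \<open>\<tau>\<close>.
\<close>

definition dominates :: "nat \<Rightarrow> (nat \<Rightarrow> nat) \<Rightarrow> (nat \<Rightarrow> nat) \<Rightarrow> bool" where
  "dominates n \<tau> \<mu> \<longleftrightarrow>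
     (\<forall>j. (\<forall>y\<le>n. count_above \<tau> j y \<le> count_above \<mu> j y) \<and> count_above \<tau> j n = count_above \<mu> j n)"

definition leading_term ::
    "nat \<Rightarrow> nat \<Rightarrow> ((nat \<Rightarrow> nat) \<Rightarrow> dyn_field) \<Rightarrow> (nat \<Rightarrow> nat) \<Rightarrow> complex \<Rightarrow> bool" where
  "leading_term N n v \<tau> C \<longleftrightarrow>
     \<tau> \<in> multi_idx N n \<and> v \<tau> = const_F C \<and> (\<forall>\<mu>\<in>multi_idx N n. v \<mu> \<noteq> 0 \<longrightarrow> dominates n \<tau> \<mu>)"

lemma multi_idx_eqI:
  assumes "\<tau> \<in> multi_idx N n" "\<mu> \<in> multi_idx N n"
    and eq: "\<And>j y. y \<le> n \<Longrightarrow> count_above \<tau> j y = count_above \<mu> j y"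
  shows "\<tau> = \<mu>"
proof -
  have "\<tau> (Suc r) = \<mu> (Suc r)" if "r < n" for r
  proof -
    have "\<tau> (Suc r) > j \<longleftrightarrow> \<mu> (Suc r) > j" for j
      using eq[of r j] eq[of "Suc r" j] that by (auto simp: of_bool_def split: if_splits)
    thus ?thesis by (meson linorder_neqE_nat order_less_irrefl)
  qed
  hence "\<tau> r = \<mu> r" if "r \<in> {1..n}" for r
    using that by (cases r) auto
  thus ?thesis
    using assms(1,2) unfolding multi_idx_def by (rule PiE_ext[rotated 2])
qed

text \<open>
  The line enters above every \<open>j \<le> k\<close>. By conservation, the count of \<open>\<beta>\<close> above such a \<open>j\<close> exceeds that of
  \<open>\<alpha>\<close> exactly at those \<open>y\<close> after which the line is no longer above \<open>j\<close>, and then by 1. For \<open>j < k\<close> this can only help. For \<open>j = k\<close> the excess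
  is needed from \<open>s\<close> on, and it is there: \<open>\<alpha>\<close> dominates \<open>\<tau>\<close>, hence has no label above \<open>k\<close> at \<open>s\<close> or later, so
  the exchange at \<open>s\<close> leaves the line with a label at most \<open>k\<close> for good. If \<open>\<beta>\<close> is the lower bound
  itself, all these inequalities are equalities, which determines \<open>\<alpha>\<close>.
\<close>

lemma L_op_transition:
  assumes p: "norm p < 1"
    and s: "1 \<le> s" "s \<le> n"
    and \<tau>: "\<tau> \<in> multi_idx N n" "\<And>r. r \<in> {1..n} \<Longrightarrow> \<tau> r \<le> k + 1" "\<And>r. r \<in> {s..n} \<Longrightarrow> \<tau> r \<le> k" "\<tau> s = k"
    and \<alpha>: "\<alpha> \<in> multi_idx N n" "dominates n \<tau> \<alpha>"
    and \<beta>: "\<beta> \<in> multi_idx N n" "T_coeff N n p \<kappa> \<omega> k (k + 1) (\<omega> s) \<beta> \<alpha> \<noteq> 0"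
  shows "dominates n (\<tau>(s := k + 1)) \<beta>" and "\<beta> = \<tau>(s := k + 1) \<Longrightarrow> \<alpha> = \<tau>"
proof -
  let ?\<tau>' = "\<tau>(s := k + 1)"
  have "aux_amplitude N p \<kappa> \<omega> (\<omega> s) (k + 1) \<alpha> \<beta> n k \<noteq> 0"
    using \<beta>(2) unfolding T_coeff_eq_aux_amplitude[OF \<alpha>(1) \<beta>(1)] .
  then obtain a where a0: "a 0 = k + 1" and an: "a n = k"
    and vertex: "\<forall>r<n. (\<omega> s \<noteq> \<omega> (Suc r) \<and> a (Suc r) = a r \<and> \<beta> (Suc r) = \<alpha> (Suc r))
                   \<or> (a (Suc r) = \<alpha> (Suc r) \<and> \<beta> (Suc r) = a r)"
    by (rule aux_amplitude_path[OF p])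
  have cons: "count_above \<beta> j y + of_bool (a y > j) = count_above \<alpha> j y + of_bool (k + 1 > j)"
    if "y \<le> n" for j y
    proof (rule path_conservation[where n = n and a = a, OF a0])
    show "y \<le> n" by (rule that)
    show "(a (Suc r) = a r \<and> \<beta> (Suc r) = \<alpha> (Suc r)) \<or> (a (Suc r) = \<alpha> (Suc r) \<and> \<beta> (Suc r) = a r)"
      if "r < n" for r
      using vertex that by blast
  qed
  have upd: "count_above ?\<tau>' j y = count_above \<tau> j y + of_bool (j = k \<and> s \<le> y)" if "y \<le> n" for j y
    using count_above_fun_upd[of \<tau> s "k + 1" j y] \<tau>(4) s
    by (cases j k rule: linorder_cases) auto
  have le: "count_above \<tau> j y \<le> count_above \<alpha> j y" if "y \<le> n" for j y
    using \<alpha>(2) that by (simp add: dominates_def)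
  have tot: "count_above \<tau> j n = count_above \<alpha> j n" for j
    using \<alpha>(2) by (simp add: dominates_def)
  have \<tau>0: "count_above \<tau> j y = 0" if "k < j" "y \<le> n" for j y
  proof -
    have "{i\<in>{1..y}. \<tau> i > j} = {}" using \<tau>(2) that by fastforce
    thus ?thesis by (simp add: count_above_def)
  qed
  have \<alpha>0: "count_above \<alpha> j y = 0" if "k < j" "y \<le> n" for j y
    using tot[of j] \<tau>0[OF that(1), of n] count_above_mono[OF that(2), of \<alpha> j] by simp
  \<comment> \<open>All labels of \<open>\<tau>\<close> above \<open>k\<close> stand before \<open>s\<close>; those of \<open>\<alpha>\<close> are as many and stand weakly further left.\<close>
  have \<alpha>_le: "\<alpha> r \<le> k" if "r \<in> {s..n}" for r
  proof -
    have "i \<in> {i\<in>{1..n}. \<tau> i > k} \<longleftrightarrow> i \<in> {i\<in>{1..s-1}. \<tau> i > k}" for i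
      using \<tau>(3)[of i] s by (cases "i < s") auto
    hence "{i\<in>{1..n}. \<tau> i > k} = {i\<in>{1..s-1}. \<tau> i > k}"
      by (rule set_eqI)
    hence "count_above \<tau> k n = count_above \<tau> k (s - 1)" by (simp add: count_above_def)
    also have "\<dots> \<le> count_above \<alpha> k (s - 1)" using s by (intro le) auto
    finally have "card {i\<in>{1..n}. \<alpha> i > k} \<le> card {i\<in>{1..s-1}. \<alpha> i > k}"
      using tot[of k] by (simp add: count_above_def)
    hence eq: "{i\<in>{1..s-1}. \<alpha> i > k} = {i\<in>{1..n}. \<alpha> i > k}"
      using s by (intro card_seteq) auto
    have "r \<notin> {i\<in>{1..s-1}. \<alpha> i > k}" using that s by auto
    hence "r \<notin> {i\<in>{1..n}. \<alpha> i > k}" unfolding eq .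
    thus ?thesis using that s by auto
  qed
  have a_le: "a y \<le> k" if "s \<le> y" "y \<le> n" for y
    using that
  proof (induction y rule: dec_induct)
    case base
    thus ?case using vertex[rule_format, of "s - 1"] \<alpha>_le[of s] s by auto
  next
    case (step y)
    thus ?case using vertex[rule_format, of y] \<alpha>_le[of "Suc y"] by auto
  qed
  show "dominates n ?\<tau>' \<beta>"
    unfolding dominates_def
  proof (intro allI conjI impI)
    fix j y assume y: "y \<le> n"
    show "count_above ?\<tau>' j y \<le> count_above \<beta> j y"
      using cons[OF y, of j] le[OF y, of j] upd[OF y, of j] a_le[of y] y \<alpha>0[of j y]
      by (cases j k rule: linorder_cases) (auto simp: of_bool_def split: if_splits)
  next
    fix j
    show "count_above ?\<tau>' j n = count_above \<beta> j n"
      using cons[of n j] upd[of n j] tot[of j] an s by (cases j k rule: linorder_cases) auto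
  qed
  show "\<alpha> = \<tau>" if "\<beta> = ?\<tau>'"
  proof (rule multi_idx_eqI[OF \<alpha>(1) \<tau>(1)])
    fix j y assume y: "y \<le> n"
    show "count_above \<alpha> j y = count_above \<tau> j y"
      using cons[OF y, of j] le[OF y, of j] upd[OF y, of j] a_le[of y] y \<alpha>0[of j y] \<tau>0[of j y]
      unfolding that
      by (cases j k rule: linorder_cases) (auto simp: of_bool_def split: if_splits)
  qed
qed

lemma multi_idx_upd:
  assumes "\<tau> \<in> multi_idx N n" "s \<in> {1..n}" "c \<in> {1..N}"
  shows "\<tau>(s := c) \<in> multi_idx N n"
  using assms by (auto simp: multi_idx_def PiE_iff extensional_def)

text \<open>
  Only the coefficient at the lower bound of the support is followed through the construction. It is a constant
  and stays one: the shift of \<open>P\<close> fixes \<open>C\<close>, and the new weights are free of \<open>P\<close>.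
\<close>

lemma leading_term_L_op:
  assumes gen: "norm p < 1" "\<kappa> \<noteq> 0" "theta p (2 * \<kappa>) \<noteq> 0"
    and k: "1 \<le> k" "k < N" and s: "1 \<le> s" "s \<le> n"
    and \<tau>: "\<And>r. r \<in> {1..n} \<Longrightarrow> \<tau> r \<le> k + 1" "\<And>r. r \<in> {s..n} \<Longrightarrow> \<tau> r \<le> k" "\<tau> s = k"
    and v: "leading_term N n v \<tau> C"
  shows "leading_term N n (L_op N n p \<kappa> \<omega> k (k + 1) (\<omega> s) v) (\<tau>(s := k + 1))
           (C * (\<Prod>r=1..n. site_factor p \<kappa> \<omega> k s \<tau> r))"
  unfolding leading_term_def
proof (intro conjI ballI impI)
  let ?T = "T_coeff N n p \<kappa> \<omega> k (k + 1) (\<omega> s)"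
  have \<tau>m: "\<tau> \<in> multi_idx N n" and v\<tau>: "v \<tau> = const_F C"
    and v_dom: "\<And>\<alpha>. \<alpha> \<in> multi_idx N n \<Longrightarrow> v \<alpha> \<noteq> 0 \<Longrightarrow> dominates n \<tau> \<alpha>"
    using v by (auto simp: leading_term_def)
  show m': "\<tau>(s := k + 1) \<in> multi_idx N n"
    using \<tau>m s k by (intro multi_idx_upd) auto
  have fin: "finite (multi_idx N n)"
    unfolding multi_idx_def by (intro finite_PiE) auto
  have "L_op N n p \<kappa> \<omega> k (k + 1) (\<omega> s) v (\<tau>(s := k + 1)) =
      (\<Sum>\<alpha>\<in>{\<tau>}. shift_F (k + 1) (v \<alpha>) * ?T (\<tau>(s := k + 1)) \<alpha>)"
    unfolding L_op_def
  proof (intro sum.mono_neutral_right fin ballI)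
    fix \<alpha> assume \<alpha>: "\<alpha> \<in> multi_idx N n - {\<tau>}"
    show "shift_F (k + 1) (v \<alpha>) * ?T (\<tau>(s := k + 1)) \<alpha> = 0"
    proof (cases "v \<alpha> = 0")
      case False
      hence "?T (\<tau>(s := k + 1)) \<alpha> = 0"
        using L_op_transition(2)[OF gen(1) s \<tau>m \<tau> _ _ m'] v_dom \<alpha> by blast
      thus ?thesis by simp
    qed simp
  qed (use \<tau>m in auto)
  also have "\<dots> = const_F C * ?T (\<tau>(s := k + 1)) \<tau>"
    by (simp add: v\<tau>)
  also have "?T (\<tau>(s := k + 1)) \<tau> = const_F (\<Prod>r=1..n. site_factor p \<kappa> \<omega> k s \<tau> r)"
  proof -
    have "1 \<le> \<tau> r" if "r \<in> {1..n}" for r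
      using \<tau>m that by (auto simp: multi_idx_def PiE_iff)
    hence "aux_amplitude N p \<kappa> \<omega> (\<omega> s) (k + 1) \<tau> (\<tau>(s := k + 1)) n k =
        of_bool (k = (if n < s then k + 1 else k)) * const_F (\<Prod>r=1..n. site_factor p \<kappa> \<omega> k s \<tau> r)"
      using gen k s \<tau> by (intro aux_amplitude_straight_path) auto
    thus ?thesis
      using s unfolding T_coeff_eq_aux_amplitude[OF \<tau>m m'] by simp
  qed
  finally show "L_op N n p \<kappa> \<omega> k (k + 1) (\<omega> s) v (\<tau>(s := k + 1)) =
      const_F (C * (\<Prod>r=1..n. site_factor p \<kappa> \<omega> k s \<tau> r))"
    by (simp only: const_F_mult)
next
  fix \<beta> assume \<beta>: "\<beta> \<in> multi_idx N n" and nz: "L_op N n p \<kappa> \<omega> k (k + 1) (\<omega> s) v \<beta> \<noteq> 0"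
  from nz obtain \<alpha> where \<alpha>: "\<alpha> \<in> multi_idx N n"
      and "shift_F (k + 1) (v \<alpha>) * T_coeff N n p \<kappa> \<omega> k (k + 1) (\<omega> s) \<beta> \<alpha> \<noteq> 0"
    unfolding L_op_def by (rule sum.not_neutral_contains_not_neutral)
  hence "v \<alpha> \<noteq> 0" and T: "T_coeff N n p \<kappa> \<omega> k (k + 1) (\<omega> s) \<beta> \<alpha> \<noteq> 0" by auto
  hence dom: "dominates n \<tau> \<alpha>" using v \<alpha> by (simp add: leading_term_def)
  have \<tau>m: "\<tau> \<in> multi_idx N n" using v by (simp add: leading_term_def)
  show "dominates n (\<tau>(s := k + 1)) \<beta>"
    using L_op_transition(1)[OF gen(1) s \<tau>m \<tau> \<alpha> dom \<beta> T] .
qed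


text \<open>
  The lower bound of the support after the operators \<open>L\<^sub>k\<^sub>,\<^sub>k\<^sub>+\<^sub>1(w\<^sub>i)\<close> with \<open>i \<le> s\<close> have acted: while \<open>k\<close> is being
  processed, a site whose final label exceeds \<open>k\<close> has the label \<open>k\<close> before its own operator acts
  and \<open>k + 1\<close> afterwards.
\<close>

definition stage :: "nat \<Rightarrow> (nat \<Rightarrow> nat) \<Rightarrow> nat \<Rightarrow> nat \<Rightarrow> nat \<Rightarrow> nat" where
  "stage n b k s = (\<lambda>i\<in>{1..n}. min (b i) (if i \<le> s then k + 1 else k))"

lemma stage_in_multi_idx:
  assumes "b \<in> multi_idx N n" "1 \<le> k"
  shows "stage n b k s \<in> multi_idx N n"
  using assms by (auto simp: stage_def multi_idx_def PiE_iff extensional_def min_le_iff_disj)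

text \<open>
  The factor \<open>site_factor\<close> for \<open>\<tau> = stage n b k (s - 1)\<close>, in terms of the final labels \<open>b\<close>: before \<open>s\<close> a label
  \<open>k + 1\<close> means a final label above \<open>k\<close>, and after \<open>s\<close> a label \<open>k\<close> means a final label of at least \<open>k\<close>.
\<close>

definition level_factor ::
    "complex \<Rightarrow> complex \<Rightarrow> (nat \<Rightarrow> complex) \<Rightarrow> (nat \<Rightarrow> nat) \<Rightarrow> nat \<Rightarrow> nat \<Rightarrow> nat \<Rightarrow> complex" where
  "level_factor p \<kappa> \<omega> b k s r =
     (if r = s then theta p (2 * \<kappa>)
      else if (if r < s then k < b r else k \<le> b r) then theta p (2 * \<kappa> + \<omega> s - \<omega> r)
      else theta p (\<omega> s - \<omega> r))"

lemma site_factor_stage: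
  assumes "r \<in> {1..n}" "s \<ge> 1"
  shows "site_factor p \<kappa> \<omega> k s (stage n b k (s - 1)) r = level_factor p \<kappa> \<omega> b k s r"
  using assms by (auto simp: site_factor_def level_factor_def stage_def)

text \<open>
  Since \<open>s\<close> increases, the sites after \<open>s\<close> have not been raised yet when the operator of \<open>s\<close>
  acts. This gives the bound \<open>k\<close> on the labels from \<open>s\<close> on that the single step requires.
\<close>

lemma leading_term_filter:
  assumes gen: "norm p < 1" "\<kappa> \<noteq> 0" "theta p (2 * \<kappa>) \<noteq> 0"
    and k: "1 \<le> k" "k < N" and b: "b \<in> multi_idx N n"
    and v: "leading_term N n v (stage n b k 0) C"
    and "y \<le> n"
  shows "leading_term N n
     (fold (\<lambda>s. L_op N n p \<kappa> \<omega> k (k + 1) (\<omega> s)) (filter (\<lambda>s. k < b s) [1..<y+1]) v) (stage n b k y)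
     (C * (\<Prod>s\<in>{s\<in>{1..y}. k < b s}. \<Prod>r=1..n. level_factor p \<kappa> \<omega> b k s r))"
  using \<open>y \<le> n\<close>
proof (induction y)
  case 0
  thus ?case using v by simp
next
  case (Suc y)
  let ?L = "\<lambda>s. L_op N n p \<kappa> \<omega> k (k + 1) (\<omega> s)"
  let ?v = "fold ?L (filter (\<lambda>s. k < b s) [1..<y+1]) v"
  let ?C = "\<lambda>y. C * (\<Prod>s\<in>{s\<in>{1..y}. k < b s}. \<Prod>r=1..n. level_factor p \<kappa> \<omega> b k s r)"
  have IH: "leading_term N n ?v (stage n b k y) (?C y)"
    using Suc by simp
  have upt: "[1..<Suc y + 1] = [1..<y+1] @ [Suc y]" by simp
  show ?case
  proof (cases "k < b (Suc y)")
    case False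
    hence "stage n b k (Suc y) = stage n b k y"
      by (auto simp: stage_def fun_eq_iff le_Suc_eq)
    moreover have "{s\<in>{1..Suc y}. k < b s} = {s\<in>{1..y}. k < b s}"
      using False by (auto simp: le_Suc_eq)
    ultimately show ?thesis
      using False IH unfolding upt filter_append by simp
  next
    case True
    have st: "(stage n b k y)(Suc y := k + 1) = stage n b k (Suc y)"
      using True Suc.prems by (auto simp: stage_def fun_eq_iff le_Suc_eq)
    have "{s\<in>{1..Suc y}. k < b s} = insert (Suc y) {s\<in>{1..y}. k < b s}"
      using True by (auto simp: le_Suc_eq)
    hence C: "?C y * (\<Prod>r=1..n. level_factor p \<kappa> \<omega> b k (Suc y) r) = ?C (Suc y)"
      by (simp add: mult_ac)
    have "leading_term N n (?L (Suc y) ?v) ((stage n b k y)(Suc y := k + 1))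
        (?C y * (\<Prod>r=1..n. site_factor p \<kappa> \<omega> k (Suc y) (stage n b k y) r))"
      using Suc.prems True
      by (intro leading_term_L_op gen k IH) (auto simp: stage_def)
    also have "(\<Prod>r=1..n. site_factor p \<kappa> \<omega> k (Suc y) (stage n b k y) r) =
        (\<Prod>r=1..n. level_factor p \<kappa> \<omega> b k (Suc y) r)"
      using site_factor_stage[of _ n "Suc y"] by (intro prod.cong) auto
    finally show ?thesis
      unfolding upt filter_append st C using True by simp
  qed
qed

lemma leading_term_basis_vector:
  assumes "\<tau> \<in> multi_idx N n"
  shows "leading_term N n (\<lambda>\<beta>. of_bool (\<beta> = \<tau>)) \<tau> 1"
proof -
  have "dominates n \<tau> \<tau>" by (simp add: dominates_def)
  thus ?thesis using assms by (simp add: leading_term_def)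
qed

lemma sorted_list_of_set_filter_upt:
  "sorted_list_of_set {s\<in>{1..n}. P s} = filter P [1..<n+1]"
proof -
  have "{s\<in>{1..n}. P s} = set (filter P [1..<n+1])"
    by auto
  thus ?thesis
    by (simp only: sorted_list_of_set.idem_if_sorted_distinct sorted_wrt_filter sorted_upt
        distinct_filter distinct_upt)
qed

lemma leading_term_L_set:
  assumes "norm p < 1" "\<kappa> \<noteq> 0" "theta p (2 * \<kappa>) \<noteq> 0"
    and "1 \<le> k" "k < N" "b \<in> multi_idx N n" "leading_term N n v (stage n b k 0) C"
  shows "leading_term N n (L_set N n p \<kappa> \<omega> k (k + 1) {s\<in>{1..n}. k < b s} v) (stage n b k n)
     (C * (\<Prod>s\<in>{s\<in>{1..n}. k < b s}. \<Prod>r=1..n. level_factor p \<kappa> \<omega> b k s r))"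
  unfolding L_set_def sorted_list_of_set_filter_upt using assms by (intro leading_term_filter) auto

lemma leading_term_xi_tilde:
  assumes gen: "norm p < 1" "\<kappa> \<noteq> 0" "theta p (2 * \<kappa>) \<noteq> 0"
    and b: "b \<in> multi_idx N n" and I: "\<And>l. l \<in> {1..N} \<Longrightarrow> I l = {i\<in>{1..n}. b i = l}"
    and "1 \<le> N"
  shows "leading_term N n (xi_tilde N n p \<kappa> \<omega> I) b
     (\<Prod>k=1..N-1. \<Prod>s\<in>{s\<in>{1..n}. k < b s}. \<Prod>r=1..n. level_factor p \<kappa> \<omega> b k s r)"
proof -
  have bN: "1 \<le> b i" "b i \<le> N" if "i \<in> {1..n}" for i
    using b that by (auto simp: multi_idx_def PiE_iff)
  have blocks: "block_union I (k + 1) N = {s\<in>{1..n}. k < b s}" for k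
    using bN I by (auto simp: block_union_def)
  have "leading_term N n
      (fold (\<lambda>k. L_set N n p \<kappa> \<omega> k (k + 1) (block_union I (k + 1) N)) [1..<m+1] (zeta n)) (stage n b (m + 1) 0)
      (\<Prod>k=1..m. \<Prod>s\<in>{s\<in>{1..n}. k < b s}. \<Prod>r=1..n. level_factor p \<kappa> \<omega> b k s r)"
    if "m + 1 \<le> N" for m
    using that
  proof (induction m)
    case 0
    have st: "stage n b (0 + 1) 0 = (\<lambda>i\<in>{1..n}. 1)"
      using bN by (auto simp: stage_def fun_eq_iff)
    have "leading_term N n (zeta n) (stage n b (0 + 1) 0) 1"
      unfolding zeta_def st [symmetric]
      by (intro leading_term_basis_vector stage_in_multi_idx b) simp
    thus ?case by simp
  next
    case (Suc m)
    let ?F = "\<lambda>m. fold (\<lambda>k. L_set N n p \<kappa> \<omega> k (k + 1) (block_union I (k + 1) N)) [1..<m+1] (zeta n)"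
    \<comment> \<open>The end of one level is the start of the next.\<close>
    have "stage n b (Suc m) n = stage n b (Suc m + 1) 0"
      by (auto simp: stage_def fun_eq_iff)
    moreover have "?F (Suc m) = L_set N n p \<kappa> \<omega> (Suc m) (Suc m + 1) {s\<in>{1..n}. Suc m < b s} (?F m)"
      using blocks[of "Suc m"] by simp
    moreover have "leading_term N n (L_set N n p \<kappa> \<omega> (Suc m) (Suc m + 1) {s\<in>{1..n}. Suc m < b s} (?F m))
        (stage n b (Suc m) n)
        ((\<Prod>k=1..m. \<Prod>s\<in>{s\<in>{1..n}. k < b s}. \<Prod>r=1..n. level_factor p \<kappa> \<omega> b k s r) *
         (\<Prod>s\<in>{s\<in>{1..n}. Suc m < b s}. \<Prod>r=1..n. level_factor p \<kappa> \<omega> b (Suc m) s r))"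
      using Suc by (intro leading_term_L_set gen b) auto
    ultimately show ?case
      by simp
  qed
  from this[of "N - 1"] have "leading_term N n (xi_tilde N n p \<kappa> \<omega> I) (stage n b N 0)
     (\<Prod>k=1..N-1. \<Prod>s\<in>{s\<in>{1..n}. k < b s}. \<Prod>r=1..n. level_factor p \<kappa> \<omega> b k s r)"
    using \<open>1 \<le> N\<close> by (simp add: xi_tilde_def)
  moreover have "stage n b N 0 = b"
    using bN b by (auto simp: stage_def fun_eq_iff multi_idx_def PiE_iff extensional_def)
  ultimately show ?thesis by simp
qed


section \<open>The weight function at its own point\<close>

lemma J_elem_bij:
  "bij_betw (J_elem n \<mu> l) {1..J_size n \<mu> l} (J_upto n \<mu> l)"
  "strict_mono_on {1..J_size n \<mu> l} (J_elem n \<mu> l)"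
proof -
  define xs where "xs = sorted_list_of_set (J_upto n \<mu> l)"
  have fin: "finite (J_upto n \<mu> l)" by (simp add: J_upto_def)
  have len: "length xs = J_size n \<mu> l" by (simp add: xs_def J_size_def)
  have "bij_betw (\<lambda>a. a - 1) {1..J_size n \<mu> l} {..<length xs}"
    by (rule bij_betwI[where g = Suc]) (auto simp: len)
  moreover have "bij_betw ((!) xs) {..<length xs} (J_upto n \<mu> l)"
    using fin by (intro bij_betw_nth) (auto simp: xs_def)
  ultimately have "bij_betw ((!) xs \<circ> (\<lambda>a. a - 1)) {1..J_size n \<mu> l} (J_upto n \<mu> l)"
    by (rule bij_betw_trans)
  thus "bij_betw (J_elem n \<mu> l) {1..J_size n \<mu> l} (J_upto n \<mu> l)"
    by (simp add: J_elem_def [abs_def] o_def xs_def)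
  show "strict_mono_on {1..J_size n \<mu> l} (J_elem n \<mu> l)"
  proof (rule strict_mono_onI)
    fix r s assume "r \<in> {1..J_size n \<mu> l}" "s \<in> {1..J_size n \<mu> l}" "r < s"
    moreover have "sorted_wrt (<) xs" by (simp add: xs_def strict_sorted_list_of_set)
    ultimately show "J_elem n \<mu> l r < J_elem n \<mu> l s"
      unfolding J_elem_def xs_def [symmetric] sorted_wrt_iff_nth_less using len by auto
  qed
qed

lemma J_elem_less_iff:
  assumes "a \<in> {1..J_size n \<mu> l}" "b \<in> {1..J_size n \<mu> l}"
  shows "J_elem n \<mu> l a < J_elem n \<mu> l b \<longleftrightarrow> a < b"
  using J_elem_bij(2)[of n \<mu> l] assms by (rule strict_mono_on_less)

lemma bij_betw_filter:
  assumes "bij_betw f A B"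
  shows "bij_betw f {x\<in>A. P (f x)} {y\<in>B. P y}"
  using assms by (auto simp: bij_betw_def inj_on_def)

text \<open>
  The factor that vanishes: if \<open>\<sigma> a > a\<close>, the site of the variable put into the position \<open>a\<close> lies
  after the site of the position \<open>a\<close>. The same variable occurs at level \<open>l + 1\<close>, since the sets \<open>J_upto\<close> increase
  with \<open>l\<close>, and the pair contributes \<open>\<theta>(1)\<close>.
\<close>

lemma U_weight_nonidentity:
  assumes p: "norm p < 1" and l: "l \<in> {1..N-1}"
    and \<sigma>: "\<sigma> permutes {1..J_size n \<mu> l}" "\<sigma> \<noteq> id"
    and t1: "\<And>b. b \<in> {1..J_size n \<mu> (l + 1)} \<Longrightarrow> t (l + 1) b = \<omega> (J_elem n \<mu> (l + 1) b)"
    and t: "\<And>a. a \<in> {1..J_size n \<mu> l} \<Longrightarrow> t l a = \<omega> (J_elem n \<mu> l (\<sigma> a))"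
  shows "U_weight N n p \<kappa> \<mu> m t = 0"
proof -
  obtain a where a: "a \<in> {1..J_size n \<mu> l}" "a < \<sigma> a"
  proof -
    have "\<exists>a\<in>{1..J_size n \<mu> l}. \<not> \<sigma> a \<le> a"
      using permutes_natset_le[OF \<sigma>(1)] \<sigma>(2) by blast
    thus ?thesis using that by (auto simp: not_le)
  qed
  have \<sigma>a: "\<sigma> a \<in> {1..J_size n \<mu> l}" using permutes_in_image[OF \<sigma>(1)] a(1) by blast
  hence "J_elem n \<mu> l (\<sigma> a) \<in> J_upto n \<mu> l" using J_elem_bij(1) bij_betwE by blast
  hence "J_elem n \<mu> l (\<sigma> a) \<in> J_upto n \<mu> (l + 1)" by (auto simp: J_upto_def)
  then obtain b where b: "b \<in> {1..J_size n \<mu> (l + 1)}" "J_elem n \<mu> (l + 1) b = J_elem n \<mu> l (\<sigma> a)"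
    using J_elem_bij(1)[of n \<mu> "l + 1"] unfolding bij_betw_def by (metis imageE)
  have "J_elem n \<mu> l a < J_elem n \<mu> (l + 1) b"
    using a \<sigma>a by (simp only: b(2) J_elem_less_iff)
  moreover have "theta p (t (l + 1) b - t l a) = 0"
    using t[OF a(1)] t1[OF b(1)] b(2) p by simp
  ultimately have zero: "(\<Prod>b\<in>{b\<in>{1..J_size n \<mu> (l + 1)}. J_elem n \<mu> (l + 1) b > J_elem n \<mu> l a}.
      const_F (theta p (t (l + 1) b - t l a) / theta p (2 * \<kappa> + t (l + 1) b - t l a))) = 0"
    using b(1) by (intro prod_zero) auto
  show ?thesis
    unfolding U_weight_def
    by (intro prod_zero finite_atLeastAtMost bexI[OF _ l] bexI[OF _ a(1)]) (simp only: zero mult_zero_left mult_zero_right)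
qed

text \<open>
  Downward induction on the level: the previous lemma needs the variables of level \<open>l + 1\<close> in their original
  order, so the permutations of the higher levels have to be eliminated first. Nothing is assumed about the
  levels below \<open>k\<close>, which are permuted by the outer sums.
\<close>

lemma W_weight_eq_U_weight:
  assumes p: "norm p < 1" and "1 \<le> N"
    and t: "\<And>l a. l \<in> {1..N} \<Longrightarrow> a \<in> {1..J_size n \<mu> l} \<Longrightarrow> (t(N := \<omega>)) l a = \<omega> (J_elem n \<mu> l a)"
  shows "W_weight N n p \<kappa> \<mu> m t \<omega> = U_weight N n p \<kappa> \<mu> m (t(N := \<omega>))"
proof -
  let ?U = "U_weight N n p \<kappa> \<mu> m"
  have "foldr (Sym_level n \<mu>) [k..<N] ?U t' = ?U t'"
    if "1 \<le> k" "k \<le> N" "\<And>l a. l \<in> {k..N} \<Longrightarrow> a \<in> {1..J_size n \<mu> l} \<Longrightarrow> t' l a = \<omega> (J_elem n \<mu> l a)" for k t'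
    using that(2,1,3)
  proof (induction k arbitrary: t' rule: inc_induct)
    case (step k)
    let ?A = "{\<sigma>. \<sigma> permutes {1..J_size n \<mu> k}}"
    have "foldr (Sym_level n \<mu>) [k..<N] ?U t' =
        (\<Sum>\<sigma>\<in>?A. foldr (Sym_level n \<mu>) [Suc k..<N] ?U (t'(k := t' k \<circ> \<sigma>)))"
      using step.hyps by (simp add: upt_conv_Cons Sym_level_def)
    also have "\<dots> = (\<Sum>\<sigma>\<in>?A. ?U (t'(k := t' k \<circ> \<sigma>)))"
      using step.prems by (intro sum.cong refl step.IH) auto
    also have "\<dots> = (\<Sum>\<sigma>\<in>{id}. ?U (t'(k := t' k \<circ> \<sigma>)))"
    proof (intro sum.mono_neutral_right ballI)
      fix \<sigma> assume \<sigma>: "\<sigma> \<in> ?A - {id}"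
      show "?U (t'(k := t' k \<circ> \<sigma>)) = 0"
      proof (rule U_weight_nonidentity[OF p, where l = k and \<sigma> = \<sigma>])
        show "(t'(k := t' k \<circ> \<sigma>)) k a = \<omega> (J_elem n \<mu> k (\<sigma> a))" if "a \<in> {1..J_size n \<mu> k}" for a
          using permutes_in_image[of \<sigma> "{1..J_size n \<mu> k}" a] \<sigma> that step by auto
      qed (use \<sigma> step in auto)
    qed (auto simp: permutes_id finite_permutations)
    finally show ?case by simp
  qed simp
  from this[of 1 "t(N := \<omega>)"] show ?thesis
    using assms unfolding W_weight_def by simp
qed

text \<open>
  For a fixed site \<open>s\<close> at level \<open>l\<close>, the factors \<open>\<theta>(w\<^sub>b/w\<^sub>s) / \<theta>(q\<^sup>2 w\<^sub>b/w\<^sub>s)\<close> run over all later sites \<open>b\<close> of level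
  \<open>l + 1\<close>. By oddness the last product is the inverse of the part with \<open>b\<close> of level \<open>l\<close>,
  so only those \<open>b\<close> remain whose label is \<open>l + 1\<close>.
\<close>

lemma U_weight_diagonal:
  assumes p: "norm p < 1" and \<kappa>: "\<kappa> \<noteq> 0" "theta p (2 * \<kappa>) \<noteq> 0"
    and \<omega>: "\<And>a b. a \<in> {1..n} \<Longrightarrow> b \<in> {1..n} \<Longrightarrow> a \<noteq> b \<Longrightarrow> theta p (\<omega> b - \<omega> a) \<noteq> 0"
      "\<And>a b. a \<in> {1..n} \<Longrightarrow> b \<in> {1..n} \<Longrightarrow> a \<noteq> b \<Longrightarrow> theta p (2 * \<kappa> + \<omega> b - \<omega> a) \<noteq> 0"
    and t: "\<And>l a. l \<in> {1..N} \<Longrightarrow> a \<in> {1..J_size n \<mu> l} \<Longrightarrow> t l a = \<omega> (J_elem n \<mu> l a)"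
  shows "U_weight N n p \<kappa> \<mu> m t = const_F (\<Prod>l=1..N-1. \<Prod>a\<in>J_upto n \<mu> l. \<Prod>b\<in>{b\<in>{1..n}. \<mu> b = l + 1 \<and> a < b}.
           theta p (\<omega> b - \<omega> a) / theta p (2 * \<kappa> + \<omega> b - \<omega> a))"
proof -
  define r where "r = (\<lambda>a b. theta p (\<omega> b - \<omega> a) / theta p (2 * \<kappa> + \<omega> b - \<omega> a))"
  define Q where "Q = (\<lambda>l a. \<Prod>b\<in>{b\<in>{1..n}. \<mu> b = l + 1 \<and> a < b}. r a b)"
  have "U_weight N n p \<kappa> \<mu> m t = (\<Prod>l=1..N-1. \<Prod>a=1..J_size n \<mu> l. const_F (Q l (J_elem n \<mu> l a)))"
    unfolding U_weight_def Let_def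
  proof (intro prod.cong refl)
    fix l a assume l: "l \<in> {1..N-1}" and a: "a \<in> {1..J_size n \<mu> l}"
    define s where "s = J_elem n \<mu> l a"
    have l': "l \<in> {1..N}" "l + 1 \<in> {1..N}" using l by auto
    have s: "s \<in> J_upto n \<mu> l"
      using J_elem_bij(1) a unfolding s_def bij_betw_def by blast
    hence s': "s \<in> J_upto n \<mu> (l + 1)" "s \<in> {1..n}" "\<mu> s \<noteq> l + 1"
      by (auto simp: J_upto_def)
    have tla: "t l a = \<omega> s" using t[OF l'(1) a] by (simp add: s_def)
    have bij: "bij_betw (J_elem n \<mu> (l + 1)) {b\<in>{1..J_size n \<mu> (l + 1)}. P (J_elem n \<mu> (l + 1) b)}
                 {b\<in>J_upto n \<mu> (l + 1). P b}" for P
      by (intro bij_betw_filter J_elem_bij)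
    have dyn: "(\<Prod>b\<in>{b\<in>{1..J_size n \<mu> (l + 1)}. J_elem n \<mu> (l + 1) b = s}.
           theta_Pi p \<kappa> m (- 2 * c * \<kappa> + t (l + 1) b - t l a) (\<mu> s) (l + 1) * const_F (theta p (2 * \<kappa>))
           / (const_F (theta p (2 * \<kappa> + t (l + 1) b - t l a)) * theta_Pi p \<kappa> m (- 2 * c * \<kappa>) (\<mu> s) (l + 1))) = 1"
      for c
    proof (intro prod.neutral ballI)
      fix b assume b: "b \<in> {b\<in>{1..J_size n \<mu> (l + 1)}. J_elem n \<mu> (l + 1) b = s}"
      hence "t (l + 1) b = \<omega> s" using t[OF l'(2), of b] by simp
      moreover have "theta_Pi p \<kappa> m (- 2 * c * \<kappa>) (\<mu> s) (l + 1) \<noteq> 0"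
        using theta_Pi_nonzero[OF p \<kappa>(1) s'(3) \<kappa>(2)] .
      ultimately show "theta_Pi p \<kappa> m (- 2 * c * \<kappa> + t (l + 1) b - t l a) (\<mu> s) (l + 1) * const_F (theta p (2 * \<kappa>))
           / (const_F (theta p (2 * \<kappa> + t (l + 1) b - t l a)) * theta_Pi p \<kappa> m (- 2 * c * \<kappa>) (\<mu> s) (l + 1)) = 1"
        using tla \<kappa>(2) by simp
    qed
    have "(\<Prod>b\<in>{b\<in>{1..J_size n \<mu> (l + 1)}. J_elem n \<mu> (l + 1) b > s}.
            const_F (theta p (t (l + 1) b - t l a) / theta p (2 * \<kappa> + t (l + 1) b - t l a))) =
          (\<Prod>b\<in>{b\<in>{1..J_size n \<mu> (l + 1)}. J_elem n \<mu> (l + 1) b > s}. const_F (r s (J_elem n \<mu> (l + 1) b)))"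
      using t[OF l'(2)] by (intro prod.cong) (auto simp: r_def tla)
    also have "\<dots> = (\<Prod>b\<in>{b\<in>J_upto n \<mu> (l + 1). b > s}. const_F (r s b))"
      by (rule prod.reindex_bij_betw[OF bij])
    finally have up: "(\<Prod>b\<in>{b\<in>{1..J_size n \<mu> (l + 1)}. J_elem n \<mu> (l + 1) b > s}.
            const_F (theta p (t (l + 1) b - t l a) / theta p (2 * \<kappa> + t (l + 1) b - t l a))) = \<dots>" .
    have "(\<Prod>b=a+1..J_size n \<mu> l. const_F (theta p (- 2 * \<kappa> + t l a - t l b) / theta p (t l a - t l b))) =
          (\<Prod>b\<in>{b\<in>{1..J_size n \<mu> l}. J_elem n \<mu> l b > s}. const_F (inverse (r s (J_elem n \<mu> l b))))"
    proof (rule prod.cong)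
      show "{a+1..J_size n \<mu> l} = {b\<in>{1..J_size n \<mu> l}. J_elem n \<mu> l b > s}"
        using a J_elem_less_iff[OF a] by (auto simp: s_def)
    next
      fix b assume "b \<in> {b\<in>{1..J_size n \<mu> l}. J_elem n \<mu> l b > s}"
      hence "t l b = \<omega> (J_elem n \<mu> l b)" using t[OF l'(1)] by simp
      moreover have "theta p (- 2 * \<kappa> + \<omega> s - \<omega> c) = - theta p (2 * \<kappa> + \<omega> c - \<omega> s)"
        "theta p (\<omega> s - \<omega> c) = - theta p (\<omega> c - \<omega> s)" for c
        using theta_minus[OF p, of "2 * \<kappa> + \<omega> c - \<omega> s"] theta_minus[OF p, of "\<omega> c - \<omega> s"]
        by (simp_all add: algebra_simps)
      ultimately show "const_F (theta p (- 2 * \<kappa> + t l a - t l b) / theta p (t l a - t l b)) =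
          const_F (inverse (r s (J_elem n \<mu> l b)))"
        by (simp only: tla r_def minus_divide_divide inverse_divide)
    qed
    also have "\<dots> = (\<Prod>b\<in>{b\<in>J_upto n \<mu> l. b > s}. const_F (inverse (r s b)))"
      by (rule prod.reindex_bij_betw[OF bij_betw_filter[OF J_elem_bij(1)]])
    finally have same: "(\<Prod>b=a+1..J_size n \<mu> l. const_F (theta p (- 2 * \<kappa> + t l a - t l b) / theta p (t l a - t l b))) = \<dots>" .
    have split: "{b\<in>J_upto n \<mu> (l + 1). b > s} = {b\<in>J_upto n \<mu> l. b > s} \<union> {b\<in>{1..n}. \<mu> b = l + 1 \<and> s < b}"
      by (auto simp: J_upto_def)
    have "(\<Prod>b\<in>{b\<in>J_upto n \<mu> (l + 1). b > s}. const_F (r s b)) =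
        (\<Prod>b\<in>{b\<in>J_upto n \<mu> l. b > s}. const_F (r s b)) * const_F (Q l s)"
      unfolding split Q_def const_F_prod by (rule prod.union_disjoint) (auto simp: J_upto_def)
    moreover have "(\<Prod>b\<in>{b\<in>J_upto n \<mu> l. b > s}. const_F (r s b)) *
        (\<Prod>b\<in>{b\<in>J_upto n \<mu> l. b > s}. const_F (inverse (r s b))) = 1"
    proof -
      have "r s b * inverse (r s b) = 1" if "b \<in> {b\<in>J_upto n \<mu> l. b > s}" for b
        using that \<omega> s'(2) by (auto simp: r_def J_upto_def)
      thus ?thesis
        unfolding prod.distrib [symmetric] const_F_mult [symmetric] by (intro prod.neutral) simp
    qed
    ultimately show "(\<Prod>b\<in>{b\<in>{1..J_size n \<mu> (l + 1)}. J_elem n \<mu> (l + 1) b = J_elem n \<mu> l a}.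
           theta_Pi p \<kappa> m (- 2 * of_int (C_exp n \<mu> (l + 1) (J_elem n \<mu> l a)) * \<kappa> + t (l + 1) b - t l a) (\<mu> (J_elem n \<mu> l a)) (l + 1) * const_F (theta p (2 * \<kappa>))
           / (const_F (theta p (2 * \<kappa> + t (l + 1) b - t l a)) *
              theta_Pi p \<kappa> m (- 2 * of_int (C_exp n \<mu> (l + 1) (J_elem n \<mu> l a)) * \<kappa>) (\<mu> (J_elem n \<mu> l a)) (l + 1))) *
        (\<Prod>b\<in>{b\<in>{1..J_size n \<mu> (l + 1)}. J_elem n \<mu> (l + 1) b > J_elem n \<mu> l a}.
           const_F (theta p (t (l + 1) b - t l a) / theta p (2 * \<kappa> + t (l + 1) b - t l a))) *
        (\<Prod>b=a+1..J_size n \<mu> l.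
           const_F (theta p (- 2 * \<kappa> + t l a - t l b) / theta p (t l a - t l b))) = const_F (Q l (J_elem n \<mu> l a))"
      unfolding s_def [symmetric] dyn up same by (simp add: mult_ac)
  qed
  also have "\<dots> = (\<Prod>l=1..N-1. \<Prod>a\<in>J_upto n \<mu> l. const_F (Q l a))"
    by (intro prod.cong refl prod.reindex_bij_betw J_elem_bij)
  finally show ?thesis
    by (simp only: Q_def r_def const_F_prod)
qed


section \<open>The factor of proportionality\<close>

text \<open>
  For each \<open>j\<close> in \<open>S\<close> the four inner products and \<open>\<theta>(q\<^sup>2)\<close> belong to a partition of the sites: those with
  a label below \<open>k\<close>, those after \<open>j\<close> with a label at least \<open>k\<close>, those before \<open>j\<close> with a label above \<open>k\<close> or equal to
  \<open>k\<close>, and \<open>j\<close> itself.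
\<close>

lemma level_product:
  fixes b :: "nat \<Rightarrow> nat" and k :: nat and n :: nat
  defines "S \<equiv> {s\<in>{1..n}. k < b s}"
  shows "(\<Prod>s\<in>S. \<Prod>r=1..n. level_factor p \<kappa> \<omega> b k s r) =
     theta p (2 * \<kappa>) ^ card S *
     ((\<Prod>j\<in>S. \<Prod>i\<in>{i\<in>{1..n}. b i < k}. theta p (\<omega> j - \<omega> i)) *
      (\<Prod>j\<in>S. \<Prod>i\<in>{i\<in>{i\<in>{1..n}. k \<le> b i}. j < i}. theta p (2 * \<kappa> + \<omega> j - \<omega> i)) *
      (\<Prod>j\<in>S. \<Prod>i\<in>{i\<in>S. j > i}. theta p (2 * \<kappa> + \<omega> j - \<omega> i)) *
      (\<Prod>j\<in>S. \<Prod>i\<in>{i\<in>{i\<in>{1..n}. b i = k}. j > i}. theta p (\<omega> j - \<omega> i)))"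
proof -
  have filter: "(\<Prod>i\<in>{i\<in>{1..n}. P i}. f i) = (\<Prod>i=1..n. if P i then f i else 1)"
    for P and f :: "nat \<Rightarrow> complex"
    by (rule prod.inter_filter) simp
  have nest: "{i\<in>{i\<in>{1..n}. P i}. Q i} = {i\<in>{1..n}. P i \<and> Q i}" for P Q :: "nat \<Rightarrow> bool"
    by auto
  have "(\<Prod>r=1..n. level_factor p \<kappa> \<omega> b k j r) = theta p (2 * \<kappa>) *
     ((\<Prod>i\<in>{i\<in>{1..n}. b i < k}. theta p (\<omega> j - \<omega> i)) *
      (\<Prod>i\<in>{i\<in>{i\<in>{1..n}. k \<le> b i}. j < i}. theta p (2 * \<kappa> + \<omega> j - \<omega> i)) *
      (\<Prod>i\<in>{i\<in>S. j > i}. theta p (2 * \<kappa> + \<omega> j - \<omega> i)) *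
      (\<Prod>i\<in>{i\<in>{i\<in>{1..n}. b i = k}. j > i}. theta p (\<omega> j - \<omega> i)))"
    if "j \<in> S" for j
  proof -
    have "(\<Prod>r=1..n. level_factor p \<kappa> \<omega> b k j r) = (\<Prod>i=1..n. if i = j then theta p (2 * \<kappa>) else 1) *
     ((\<Prod>i\<in>{i\<in>{1..n}. b i < k}. theta p (\<omega> j - \<omega> i)) *
      (\<Prod>i\<in>{i\<in>{i\<in>{1..n}. k \<le> b i}. j < i}. theta p (2 * \<kappa> + \<omega> j - \<omega> i)) *
      (\<Prod>i\<in>{i\<in>S. j > i}. theta p (2 * \<kappa> + \<omega> j - \<omega> i)) *
      (\<Prod>i\<in>{i\<in>{i\<in>{1..n}. b i = k}. j > i}. theta p (\<omega> j - \<omega> i)))"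
      unfolding S_def nest filter prod.distrib [symmetric]
      using that by (intro prod.cong refl) (auto simp: S_def level_factor_def)
    also have "(\<Prod>i=1..n. if i = j then theta p (2 * \<kappa>) else 1) = theta p (2 * \<kappa>)"
      using that by (subst prod.delta) (auto simp: S_def)
    finally show ?thesis .
  qed
  thus ?thesis
    by (simp add: prod.distrib)
qed

text \<open>
  Both sides count each site \<open>s\<close> with multiplicity \<open>b s - 1\<close>.
\<close>

lemma sum_block_sizes:
  fixes b :: "nat \<Rightarrow> nat"
  assumes "\<And>i. i \<in> {1..n} \<Longrightarrow> b i \<in> {1..N}"
  shows "(\<Sum>k=1..N-1. card {s\<in>{1..n}. k < b s}) = (\<Sum>k=2..N. (k - 1) * card {s\<in>{1..n}. b s = k})"
proof -
  have card: "card {s\<in>{1..n}. P s} = (\<Sum>s=1..n. of_bool (P s))" for P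
    unfolding card_eq_sum of_bool_def by (rule sum.inter_filter) simp
  have "(\<Sum>k=1..N-1. card {s\<in>{1..n}. k < b s}) = (\<Sum>k=1..N-1. \<Sum>s=1..n. of_bool (k < b s))"
    by (simp only: card)
  also have "\<dots> = (\<Sum>s=1..n. \<Sum>k=1..N-1. of_bool (k < b s))"
    by (rule sum.swap)
  also have "\<dots> = (\<Sum>s=1..n. b s - 1)"
  proof (intro sum.cong refl)
    fix s assume "s \<in> {1..n}"
    hence "{1..N-1} \<inter> {k. k < b s} = {1..<b s}" using assms[of s] by auto
    thus "(\<Sum>k=1..N-1. of_bool (k < b s)) = b s - 1"
      by simp
  qed
  also have "\<dots> = (\<Sum>k=1..N. \<Sum>s\<in>{s\<in>{1..n}. b s = k}. b s - 1)"
    using assms by (intro sum.group [symmetric]) auto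
  also have "\<dots> = (\<Sum>k=1..N. (k - 1) * card {s\<in>{1..n}. b s = k})"
    by (intro sum.cong refl) simp
  also have "\<dots> = (\<Sum>k=2..N. (k - 1) * card {s\<in>{1..n}. b s = k})"
    by (intro sum.mono_neutral_right) auto
  finally show ?thesis .
qed

text \<open>
  Both sides run over the pairs \<open>a < b\<close> with \<open>\<mu> a < \<mu> b\<close>. The left one groups them by both labels, the right one
  by the label of \<open>b\<close> alone.
\<close>

lemma prod_block_pairs:
  fixes f :: "nat \<Rightarrow> nat \<Rightarrow> complex"
  shows "(\<Prod>k=1..N. \<Prod>l=k+1..N. \<Prod>a\<in>{i\<in>{1..n}. \<mu> i = k}. \<Prod>b\<in>{b\<in>{i\<in>{1..n}. \<mu> i = l}. a < b}. f a b) =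
    (\<Prod>l=1..N-1. \<Prod>a\<in>J_upto n \<mu> l. \<Prod>b\<in>{b\<in>{1..n}. \<mu> b = l + 1 \<and> a < b}. f a b)"
proof -
  let ?F = "\<lambda>k l. \<Prod>a\<in>{i\<in>{1..n}. \<mu> i = k}. \<Prod>b\<in>{b\<in>{i\<in>{1..n}. \<mu> i = l}. a < b}. f a b"
  have "(\<Prod>a\<in>J_upto n \<mu> l. \<Prod>b\<in>{b\<in>{1..n}. \<mu> b = l + 1 \<and> a < b}. f a b) = (\<Prod>k=1..l. ?F k (l + 1))" for l
  proof -
    have "{a\<in>J_upto n \<mu> l. \<mu> a = k} = {i\<in>{1..n}. \<mu> i = k}" if "k \<in> {1..l}" for k
      using that by (auto simp: J_upto_def)
    moreover have "(\<Prod>a\<in>J_upto n \<mu> l. \<Prod>b\<in>{b\<in>{1..n}. \<mu> b = l + 1 \<and> a < b}. f a b) =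
      (\<Prod>k=1..l. \<Prod>a\<in>{a\<in>J_upto n \<mu> l. \<mu> a = k}. \<Prod>b\<in>{b\<in>{1..n}. \<mu> b = l + 1 \<and> a < b}. f a b)"
      by (intro prod.group [symmetric]) (auto simp: J_upto_def)
    ultimately show ?thesis
      by (simp add: conj_assoc)
  qed
  hence "(\<Prod>l=1..N-1. \<Prod>a\<in>J_upto n \<mu> l. \<Prod>b\<in>{b\<in>{1..n}. \<mu> b = l + 1 \<and> a < b}. f a b) =
      (\<Prod>l=1..N-1. \<Prod>k=1..l. ?F k (l + 1))"
    by (simp only:)
  also have "\<dots> = (\<Prod>(l, k)\<in>Sigma {1..N-1} (\<lambda>l. {1..l}). ?F k (l + 1))"
    by (rule prod.Sigma) auto
  also have "\<dots> = (\<Prod>(k, l)\<in>Sigma {1..N} (\<lambda>k. {k+1..N}). ?F k l)"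
    by (rule prod.reindex_bij_witness[where i = "\<lambda>(k, l). (l - 1, k)" and j = "\<lambda>(l, k). (k, l + 1)"]) auto
  also have "\<dots> = (\<Prod>k=1..N. \<Prod>l=k+1..N. ?F k l)"
    by (rule prod.Sigma [symmetric]) auto
  finally show ?thesis ..
qed

theorem corollary6p7:
  fixes N n :: nat and q p \<kappa> :: complex and w \<omega> :: "nat \<Rightarrow> complex"
    and I :: "nat \<Rightarrow> nat set" and Nw :: dyn_field
  assumes N: "N \<ge> 1"
    and q: "q = exp \<kappa>" "norm q < 1"
    and p: "p \<noteq> 0" "norm p < 1"
    and qp_generic: "\<And>a b :: int. q powi a = p powi b \<Longrightarrow> a = 0 \<and> b = 0"
    and w: "\<And>i. i \<in> {1..n} \<Longrightarrow> w i = exp (\<omega> i)"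
    and w_generic: "\<And>i j (a :: int) (b :: int). i \<in> {1..n} \<Longrightarrow> j \<in> {1..n} \<Longrightarrow> i \<noteq> j \<Longrightarrow>
                      w i / w j \<noteq> q powi a * p powi b"
    and I: "ordered_partition N n I"
    and Nw: "\<And>\<mu>. \<mu> \<in> multi_idx N n \<Longrightarrow>
               xi_tilde N n p \<kappa> \<omega> I \<mu> = Nw * xi_GT N n p \<kappa> \<omega> I \<mu>"
  shows "Nw = const_F (
      theta p (2 * \<kappa>) ^ (\<Sum>k=2..N. (k - 1) * card (I k)) *
      (\<Prod>k=1..N. \<Prod>l=k+1..N. \<Prod>a\<in>I k. \<Prod>b\<in>{b \<in> I l. a < b}.
         theta p (2 * \<kappa> + \<omega> b - \<omega> a) / theta p (\<omega> b - \<omega> a)) *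
      (\<Prod>l=1..N-1.
         (\<Prod>j\<in>block_union I (N - l + 1) N. \<Prod>k\<in>block_union I 1 (N - l - 1).
            theta p (\<omega> j - \<omega> k)) *
         (\<Prod>j\<in>block_union I (N - l + 1) N. \<Prod>k\<in>{k \<in> block_union I (N - l) N. j < k}.
            theta p (2 * \<kappa> + \<omega> j - \<omega> k)) *
         (\<Prod>j\<in>block_union I (N - l + 1) N. \<Prod>k\<in>{k \<in> block_union I (N - l + 1) N. j > k}.
            theta p (2 * \<kappa> + \<omega> j - \<omega> k)) *
         (\<Prod>j\<in>block_union I (N - l + 1) N. \<Prod>k\<in>{k \<in> I (N - l). j > k}.
            theta p (\<omega> j - \<omega> k))))"
proof -
  have \<kappa>: "\<kappa> \<noteq> 0"
    using q by auto
  have "exp (2 * \<kappa>) \<noteq> p powi b" for b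
    using qp_generic[of 2 b] q(1) by (auto simp: exp_double)
  hence \<theta>\<kappa>: "theta p (2 * \<kappa>) \<noteq> 0"
    using p by (intro theta_nonzero) auto
  note gen = p(2) \<kappa> \<theta>\<kappa>
  \<comment> \<open>The cases \<open>c = 0\<close> and \<open>c = 1\<close> give the two kinds of denominators.\<close>
  have \<theta>w: "theta p (2 * of_nat c * \<kappa> + \<omega> b - \<omega> a) \<noteq> 0"
    if "a \<in> {1..n}" "b \<in> {1..n}" "a \<noteq> b" for a b c
  proof (intro theta_nonzero p)
    fix m :: int
    have "exp (2 * of_nat c * \<kappa> + \<omega> b - \<omega> a) = q ^ (2 * c) * (w b / w a)"
      using w[OF that(1)] w[OF that(2)] q(1) exp_of_nat_mult[of "2 * c" \<kappa>]
      by (simp add: exp_diff exp_add)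
    moreover have "q ^ (2 * c) * (w b / w a) \<noteq> p powi m"
    proof
      assume "q ^ (2 * c) * (w b / w a) = p powi m"
      hence "w b / w a = q powi (- int (2 * c)) * p powi m"
        unfolding power_int_minus power_int_of_nat using q(1) by (simp add: field_simps)
      thus False using w_generic[OF that(2,1)] that(3) by blast
    qed
    ultimately show "exp (2 * of_nat c * \<kappa> + \<omega> b - \<omega> a) \<noteq> p powi m" by simp
  qed
  have \<theta>0: "theta p (\<omega> b - \<omega> a) \<noteq> 0" if "a \<in> {1..n}" "b \<in> {1..n}" "a \<noteq> b" for a b
    using \<theta>w[OF that, of 0] by simp
  have \<theta>1: "theta p (2 * \<kappa> + \<omega> b - \<omega> a) \<noteq> 0" if "a \<in> {1..n}" "b \<in> {1..n}" "a \<noteq> b" for a b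
    using \<theta>w[OF that, of 1] by simp

  have cover: "(\<Union>l\<in>{1..N}. I l) = {1..n}" and disj: "disjoint_family_on I {1..N}"
    using I by (auto simp: ordered_partition_def)
  have "\<forall>i\<in>{1..n}. \<exists>l\<in>{1..N}. i \<in> I l"
    using cover by blast
  then obtain f where f: "\<And>i. i \<in> {1..n} \<Longrightarrow> f i \<in> {1..N} \<and> i \<in> I (f i)"
    by metis
  define b where "b = restrict f {1..n}"
  have b: "b \<in> multi_idx N n"
    using f by (auto simp: b_def multi_idx_def)
  have bN: "b i \<in> {1..N}" if "i \<in> {1..n}" for i
    using f that by (simp add: b_def)
  have Ib: "I l = {i\<in>{1..n}. b i = l}" if "l \<in> {1..N}" for l
  proof
    show "I l \<subseteq> {i\<in>{1..n}. b i = l}"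
    proof
      fix i assume i: "i \<in> I l"
      hence i': "i \<in> {1..n}" using cover that by blast
      have "f i = l"
        using disjoint_family_onD[OF disj, of "f i" l] f[OF i'] i that by blast
      thus "i \<in> {i\<in>{1..n}. b i = l}" using i' by (simp add: b_def)
    qed
    show "{i\<in>{1..n}. b i = l} \<subseteq> I l"
      using f by (auto simp: b_def)
  qed
  have blocks: "block_union I c d = {i\<in>{1..n}. b i \<in> {c..d}}" if "1 \<le> c" "d \<le> N" for c d
    using Ib that by (auto simp: block_union_def)

  \<comment> \<open>The two coordinates at \<open>v\<^sub>b\<close>.\<close>
  define X where "X = (\<Prod>k=1..N-1. \<Prod>s\<in>{s\<in>{1..n}. k < b s}. \<Prod>r=1..n. level_factor p \<kappa> \<omega> b k s r)"
  define D where "D = (\<Prod>l=1..N-1. \<Prod>a\<in>J_upto n b l. \<Prod>c\<in>{c\<in>{1..n}. b c = l + 1 \<and> a < c}.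
           theta p (\<omega> c - \<omega> a) / theta p (2 * \<kappa> + \<omega> c - \<omega> a))"
  have "xi_tilde N n p \<kappa> \<omega> I b = const_F X"
    using leading_term_xi_tilde[OF gen b Ib N] by (simp add: leading_term_def X_def)
  moreover have "xi_GT N n p \<kappa> \<omega> I b = const_F D"
  proof -
    have t: "((specialize \<omega> I)(N := \<omega>)) l a = \<omega> (J_elem n b l a)"
      if l: "l \<in> {1..N}" and a: "a \<in> {1..J_size n b l}" for l a
    proof (cases "l = N")
      case True
      have J: "J_upto n b N = {1..n}"
        using bN by (auto simp: J_upto_def)
      hence "J_elem n b N a = [1..<n+1] ! (a - 1)"
        using sorted_list_of_set_range[of 1 "Suc n"]
        by (simp only: J_elem_def atLeastLessThanSuc_atLeastAtMost Suc_eq_plus1 [symmetric])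
      moreover have "a \<in> {1..n}" using a True J by (simp add: J_size_def)
      ultimately show ?thesis using True by (simp add: nth_upt del: upt_Suc)
    next
      case False
      have "block_union I 1 l = J_upto n b l"
        using blocks[of 1 l] l by (simp add: J_upto_def)
      thus ?thesis using False by (simp add: specialize_def J_elem_def)
    qed
    have "W_weight N n p \<kappa> b m (specialize \<omega> I) \<omega> = const_F D" for m
    proof -
      have "W_weight N n p \<kappa> b m (specialize \<omega> I) \<omega> =
          U_weight N n p \<kappa> b m ((specialize \<omega> I)(N := \<omega>))"
        by (rule W_weight_eq_U_weight[OF p(2) N]) (rule t)
      also have "\<dots> = const_F D"
        unfolding D_def by (rule U_weight_diagonal[OF gen]) (assumption | rule \<theta>0 \<theta>1 t)+
      finally show ?thesis .
    qed
    thus ?thesis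
      using b Ib by (simp add: xi_GT_def)
  qed
  ultimately have eq: "const_F X = Nw * const_F D"
    using Nw[OF b] by simp
  have D: "D \<noteq> 0"
    using \<theta>0 \<theta>1 by (auto simp: D_def J_upto_def)
  have "const_F (X * inverse D) = Nw * const_F (D * inverse D)"
    using eq by (simp only: const_F_mult mult.assoc)
  hence "Nw = const_F (X * inverse D)"
    using D by simp

  also have "inverse D = (\<Prod>k=1..N. \<Prod>l=k+1..N. \<Prod>a\<in>I k. \<Prod>b\<in>{b \<in> I l. a < b}.
         theta p (2 * \<kappa> + \<omega> b - \<omega> a) / theta p (\<omega> b - \<omega> a))"
  proof -
    have "inverse D = (\<Prod>l=1..N-1. \<Prod>a\<in>J_upto n b l. \<Prod>c\<in>{c\<in>{1..n}. b c = l + 1 \<and> a < c}.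
           theta p (2 * \<kappa> + \<omega> c - \<omega> a) / theta p (\<omega> c - \<omega> a))"
      unfolding D_def by (simp only: prod_inversef [symmetric] o_def inverse_divide)
    also have "\<dots> = (\<Prod>k=1..N. \<Prod>l=k+1..N. \<Prod>a\<in>{i\<in>{1..n}. b i = k}. \<Prod>c\<in>{c\<in>{i\<in>{1..n}. b i = l}. a < c}.
           theta p (2 * \<kappa> + \<omega> c - \<omega> a) / theta p (\<omega> c - \<omega> a))"
      by (rule prod_block_pairs [symmetric])
    also have "\<dots> = (\<Prod>k=1..N. \<Prod>l=k+1..N. \<Prod>a\<in>I k. \<Prod>b\<in>{b \<in> I l. a < b}.
         theta p (2 * \<kappa> + \<omega> b - \<omega> a) / theta p (\<omega> b - \<omega> a))"
      by (intro prod.cong) (auto simp: Ib)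
    finally show ?thesis .
  qed
  also have "X = theta p (2 * \<kappa>) ^ (\<Sum>k=2..N. (k - 1) * card (I k)) *
      (\<Prod>l=1..N-1.
         (\<Prod>j\<in>block_union I (N - l + 1) N. \<Prod>k\<in>block_union I 1 (N - l - 1).
            theta p (\<omega> j - \<omega> k)) *
         (\<Prod>j\<in>block_union I (N - l + 1) N. \<Prod>k\<in>{k \<in> block_union I (N - l) N. j < k}.
            theta p (2 * \<kappa> + \<omega> j - \<omega> k)) *
         (\<Prod>j\<in>block_union I (N - l + 1) N. \<Prod>k\<in>{k \<in> block_union I (N - l + 1) N. j > k}.
            theta p (2 * \<kappa> + \<omega> j - \<omega> k)) *
         (\<Prod>j\<in>block_union I (N - l + 1) N. \<Prod>k\<in>{k \<in> I (N - l). j > k}.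
            theta p (\<omega> j - \<omega> k)))" (is "_ = _ * (\<Prod>l=1..N-1. ?G l)")
  proof -
    have G: "(\<Prod>s\<in>{s\<in>{1..n}. N - l < b s}. \<Prod>r=1..n. level_factor p \<kappa> \<omega> b (N - l) s r) =
        theta p (2 * \<kappa>) ^ card {s\<in>{1..n}. N - l < b s} * ?G l" if l: "l \<in> {1..N-1}" for l
    proof -
      have "block_union I (N - l + 1) N = {s\<in>{1..n}. N - l < b s}"
        using blocks[of "N - l + 1" N] bN by auto
      moreover have "block_union I 1 (N - l - 1) = {i\<in>{1..n}. b i < N - l}"
        using blocks[of 1 "N - l - 1"] bN l by force
      moreover have "block_union I (N - l) N = {i\<in>{1..n}. N - l \<le> b i}"
        using blocks[of "N - l" N] bN l by auto
      moreover have "I (N - l) = {i\<in>{1..n}. b i = N - l}"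
        using l by (intro Ib) auto
      ultimately show ?thesis
        by (simp only: level_product)
    qed
    \<comment> \<open>The theorem numbers the levels from the top, \<open>k = N - l\<close>.\<close>
    have flip: "(\<Prod>k=1..N-1. h k) = (\<Prod>l=1..N-1. h (N - l))" for h :: "nat \<Rightarrow> complex"
      by (rule prod.reindex_bij_witness[where i = "\<lambda>l. N - l" and j = "\<lambda>l. N - l"]) auto
    have "X = (\<Prod>l=1..N-1. theta p (2 * \<kappa>) ^ card {s\<in>{1..n}. N - l < b s} * ?G l)"
      unfolding X_def by (subst flip) (intro prod.cong refl G)
    also have "\<dots> = (\<Prod>l=1..N-1. theta p (2 * \<kappa>) ^ card {s\<in>{1..n}. N - l < b s}) * (\<Prod>l=1..N-1. ?G l)"
      by (rule prod.distrib)
    also have "(\<Prod>l=1..N-1. theta p (2 * \<kappa>) ^ card {s\<in>{1..n}. N - l < b s}) =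
        theta p (2 * \<kappa>) ^ (\<Sum>k=1..N-1. card {s\<in>{1..n}. k < b s})"
      by (subst flip [symmetric]) (simp only: power_sum)
    also have "(\<Sum>k=1..N-1. card {s\<in>{1..n}. k < b s}) =
        (\<Sum>k=2..N. (k - 1) * card {s\<in>{1..n}. b s = k})"
      by (rule sum_block_sizes) (rule bN)
    also have "\<dots> = (\<Sum>k=2..N. (k - 1) * card (I k))"
      by (intro sum.cong refl) (simp add: Ib)
    finally show ?thesis .
  qed
  finally show ?thesis
    by (simp only: mult_ac)
qed

end
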